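(* Let $m$ be an odd integer such that $q=2m^2-1$ is a prime power, and let $\omega$ be a primitive element of $\mathbb{F}_{q^2}$, $C_i^{(e,q^2)}=\omega^i\langle\omega^e\rangle$. Let $X_0=\{0\}$ and let $X_1,\dots,X_4$ partition $\mathbb{F}_{q^2}\setminus\{0\}$ such that: (1) $X_1=\omega^{2m^2}X_3$, $X_2=\omega^{2m^2}X_4$; (2) each $X_i$ is a union of cosets of $C_0^{(4m^2,q^2)}$; (3) with $R_i=\{(x,y):x-y\in X_i\}$, $(\mathbb{F}_{q^2},\{R_i\}_{i=0}^4)$ is a four-class association scheme, and there is $\tau\in\{1,-1\}$ such that, setting $Y_0=\{0\}$, $Y_j=\omega^{-m^2\tau}X_j^q$ ($X_j^q=\{x^q:x\in X_j\}$) and $g=G_q(\eta)$, for every $a\in Y_j$ the values $\psi_{\mathbb{F}_{q^2}}(aX_i)=\sum_{x\in X_i}\psi_{\mathbb{F}_{q^2}}(ax)$ for $i=1,2,3,4$ are: - $a\in Y_0$: $m(m^2-1)(m-1)$, $m(m^2-1)(m+1)$, $m(m^2-1)(m-1)$, $m(m^2-1)(m+1)$; - $a\in Y_1$: $\frac{m^2+m-1}{2}-\frac{m}{2}g$, $\frac{-m^2-m}{2}-\frac{m+1}{2}g$, $\frac{m^2+m-1}{2}+\frac{m}{2}g$, $\frac{-m^2-m}{2}+\frac{m+1}{2}g$; - $a\in Y_2$: $\frac{-m^2+m}{2}-\frac{m-1}{2}g$, $\frac{m^2-m-1}{2}+\frac{m}{2}g$, $\frac{-m^2+m}{2}+\frac{m-1}{2}g$,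 $\frac{m^2-m-1}{2}-\frac{m}{2}g$; - $a\in Y_3$: $\frac{m^2+m-1}{2}+\frac{m}{2}g$, $\frac{-m^2-m}{2}+\frac{m+1}{2}g$, $\frac{m^2+m-1}{2}-\frac{m}{2}g$, $\frac{-m^2-m}{2}-\frac{m+1}{2}g$; - $a\in Y_4$: $\frac{-m^2+m}{2}+\frac{m-1}{2}g$, $\frac{m^2-m-1}{2}-\frac{m}{2}g$, $\frac{-m^2+m}{2}-\frac{m-1}{2}g$, $\frac{m^2-m-1}{2}+\frac{m}{2}g$. Let $\ell$ be an integer not divisible by $q+1$ such that $\omega^\ell\in X_2\cup X_4$ and $\omega^{\ell q}-\omega^\ell\in C_{\tau m^2}^{(4m^2,q^2)}$. Let $(S_0,S_1)=(X_1\cup X_4,X_1\cup X_2)$ if $\omega^\ell\in X_2$ and $(S_0,S_1)=(X_2\cup X_3,X_3\cup X_4)$ if $\omega^\ell\in X_4$, and $D_{\ell,S_d}=\{x\in\mathbb{F}_q:1+x\omega^\ell\in S_d\}$, $d=0,1$. Then $|D_{\ell,S_0}|=m^2-m$, $|D_{\ell,S_1}|=m^2$, \[ \{|D_{\ell,S_0}\cap((C_0^{(2,q)}\cup\{0\})+s)|+|D_{\ell,S_1}\cap(C_0^{(2,q)}+s)|: s\in\mathbb{F}_q\}=\{m^2-m,m^2\}, \] and \[ \{|D_{\ell,S_0}\cap(C_0^{(2,q)}+s)|+|D_{\ell,S_1}\cap((\mathbb{F}_q^*\setminus C_0^{(2,q)})+s)|: s\in\mathbb{F}_q\}=\{m^2-m,m^2\},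 \] where $C_0^{(2,q)}$ is the set of nonzero squares of $\mathbb{F}_q$.
   Context: For a prime power $Q=p^f$, the canonical additive character of $\mathbb{F}_Q$ is $\psi_{\mathbb{F}_Q}(x)=\exp(2\pi i\,\mathrm{Tr}_{Q/p}(x)/p)$; for a multiplicative character $\chi$ of $\mathbb{F}_Q$ the Gauss sum is $G_Q(\chi)=\sum_{x\in\mathbb{F}_Q^*}\chi(x)\psi_{\mathbb{F}_Q}(x)$; $\eta$ is the quadratic character of $\mathbb{F}_q$. A $d$-class association scheme on a finite set $X$ is a partition $R_0=\{(x,x)\},R_1,\dots,R_d$ of $X\times X$ such that each transpose of an $R_i$ is some $R_{i'}$ and for all $i,j,k$ the number of $z$ with $(x,z)\in R_i,(z,y)\in R_j$ is the same for all $(x,y)\in R_k$. The subscript $\tau m^2$ of $C_{\tau m^2}^{(4m^2,q^2)}$ is taken modulo $4m^2$. *)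

theory Defs
  imports "HOL-Analysis.Analysis"
begin

text \<open>
  Finite fields are realised inside one ambient finite field type \<open>'a\<close> of characteristic \<open>p\<close>:
  the field with \<open>Q\<close> elements, if contained in \<open>'a\<close>, is the set of roots of \<open>x ^ Q = x\<close>.
\<close>

definition GF :: "nat \<Rightarrow> 'a::field set" where
  "GF Q = {x. x ^ Q = x}"

definition abs_trace :: "nat \<Rightarrow> nat \<Rightarrow> 'a::field \<Rightarrow> 'a" where
  "abs_trace p f x = (\<Sum>i<f. x ^ (p ^ i))"

text \<open>
  For \<open>x\<close> in the field with \<open>p ^ f\<close> elements the trace lies in the prime field, whose elements
  are the \<open>of_nat n\<close> with \<open>n < p\<close>.
\<close>

definition add_char :: "nat \<Rightarrow> nat \<Rightarrow> 'a::field \<Rightarrow> complex" where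
  "add_char p f x =
     exp (2 * of_real pi * \<i> * of_nat (THE n. n < p \<and> of_nat n = abs_trace p f x) / of_nat p)"

definition add_char_sum :: "nat \<Rightarrow> nat \<Rightarrow> 'a::field \<Rightarrow> 'a set \<Rightarrow> complex" where
  "add_char_sum p f a S = (\<Sum>x\<in>S. add_char p f (a * x))"

definition gauss_sum :: "nat \<Rightarrow> nat \<Rightarrow> ('a::field \<Rightarrow> complex) \<Rightarrow> complex" where
  "gauss_sum p f \<theta> = (\<Sum>x\<in>GF (p ^ f) - {0}. \<theta> x * add_char p f x)"

definition nonzero_squares :: "'a::field set \<Rightarrow> 'a set" where
  "nonzero_squares K = {y ^ 2 | y. y \<in> K \<and> y \<noteq> 0}"

definition quadratic_char :: "'a::field set \<Rightarrow> 'a \<Rightarrow> complex" where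
  "quadratic_char K x = (if x = 0 then 0 else if x \<in> nonzero_squares K then 1 else - 1)"

definition primitive_element :: "'a::field \<Rightarrow> bool" where
  "primitive_element \<omega> \<longleftrightarrow> range (\<lambda>k::nat. \<omega> ^ k) = UNIV - {0}"

definition cyclotomic_class :: "'a::field \<Rightarrow> int \<Rightarrow> int \<Rightarrow> 'a set" where
  "cyclotomic_class \<omega> e i = {\<omega> powi i * (\<omega> powi e) powi k | k. True}"

definition translate :: "'a::plus set \<Rightarrow> 'a \<Rightarrow> 'a set" where
  "translate A s = (\<lambda>x. x + s) ` A"

definition association_scheme :: "'b set \<Rightarrow> nat \<Rightarrow> (nat \<Rightarrow> ('b \<times> 'b) set) \<Rightarrow> bool" where
  "association_scheme V d R \<longleftrightarrow>
     finite V \<and>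
     R 0 = {(x, x) | x. x \<in> V} \<and>
     (\<Union>i\<in>{0..d}. R i) = V \<times> V \<and>
     disjoint_family_on R {0..d} \<and>
     (\<forall>i\<in>{0..d}. R i \<noteq> {}) \<and>
     (\<forall>i\<in>{0..d}. \<exists>i'\<in>{0..d}. (R i)\<inverse> = R i') \<and>
     (\<forall>i\<in>{0..d}. \<forall>j\<in>{0..d}. \<forall>k\<in>{0..d}. \<exists>n. \<forall>(x, y)\<in>R k.
        card {z \<in> V. (x, z) \<in> R i \<and> (z, y) \<in> R j} = n)"

end

theory Submission
  imports Defs "HOL-Number_Theory.Residues"
begin

text \<open>
  Let \<open>K\<close> be the subfield of order \<open>q\<close> and \<open>L = \<omega> powi l\<close>. The function \<open>h\<close> that is \<open>1\<close> on \<open>S\<^sub>0\<close>,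
  \<open>- 1\<close> on the other nonzero elements and \<open>0\<close> at \<open>0\<close> satisfies \<open>h (c * z) = \<eta> c * h z\<close> for \<open>c\<close> in
  \<open>K\<close>, and so does its analogue for \<open>S\<^sub>1\<close>. Writing \<open>z = t * u + y * v\<close> with \<open>t\<close> and \<open>y\<close> in \<open>K\<close>, the
  Fourier coefficient of such an \<open>h\<close> at \<open>v ^ q / (v ^ q * u - v * u ^ q)\<close> factors as the Gauss sum
  times the sum of \<open>h\<close> over the affine line \<open>u + K * v\<close>. Since the Gauss sum is nonzero, the
  character table determines these line sums. The line \<open>1 + K * L\<close> gives the cardinalities, and
  the substitution \<open>x = s + 1 / y\<close> turns the sum of \<open>h (1 + x * L) * \<eta> (x - s)\<close> over \<open>x\<close> into a sum
  over the line \<open>L + K * (1 + s * L)\<close>, which gives the intersections with the translates of the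
  squares.
\<close>

section \<open>Finite fields\<close>

lemma card_roots_unity_idom:
  assumes "n > 0"
  shows "card {x :: 'a::idom. x ^ n = 1} \<le> n"
proof -
  define P :: "'a poly" where "P = Polynomial.monom 1 n - 1"
  have "Polynomial.coeff P n = 1"
    using assms by (simp add: P_def)
  then have "P \<noteq> 0"
    by auto
  then have "card {x. poly P x = 0} \<le> degree P"
    by (rule card_poly_roots_bound)
  also have "\<dots> \<le> n"
    unfolding P_def by (rule degree_diff_le) (simp_all add: degree_monom_le)
  finally show ?thesis
    by (simp add: P_def poly_monom)
qed

lemma card_roots_sum_powers:
  fixes e :: "nat \<Rightarrow> nat"
  assumes "inj_on e {..<k}" "k > 0" "\<And>i. i < k \<Longrightarrow> e i \<le> d"
  shows "card {x :: 'a::idom. (\<Sum>i<k. x ^ e i) = 0} \<le> d"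
proof -
  define P :: "'a poly" where "P = (\<Sum>i<k. Polynomial.monom 1 (e i))"
  have "Polynomial.coeff P (e 0) = (\<Sum>i<k. if i = 0 then 1 else 0)"
    unfolding P_def coeff_sum coeff_monom using assms(2)
    by (intro sum.cong refl if_cong) (auto simp: inj_on_eq_iff[OF assms(1)])
  then have "P \<noteq> 0"
    using assms(2) by auto
  then have "card {x. poly P x = 0} \<le> degree P"
    by (rule card_poly_roots_bound)
  also have "\<dots> \<le> d"
    unfolding P_def
    by (intro degree_sum_le) (auto intro: order.trans[OF degree_monom_le] assms(3))
  finally show ?thesis
    by (simp add: P_def poly_sum poly_monom)
qed

lemma two_le_CARD_field: "2 \<le> CARD('a::{field,finite})"
  using card_mono[of "UNIV :: 'a set" "{0, 1}"] by simp

lemma power_CARD_minus_one_eq_one: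
  fixes x :: "'a::{field,finite}"
  assumes "x \<noteq> 0"
  shows "x ^ (CARD('a) - 1) = 1"
proof -
  have "(\<Prod>y\<in>UNIV - {0}. x * y) = (\<Prod>y\<in>UNIV - {0}. y)"
    by (rule prod.reindex_bij_witness[of _ "\<lambda>y. y / x" "\<lambda>y. x * y"]) (use assms in auto)
  moreover have "(\<Prod>y\<in>UNIV - {0}. x * y) = x ^ (CARD('a) - 1) * (\<Prod>y\<in>UNIV - {0}. y)"
    by (simp add: prod.distrib card_Diff_singleton)
  moreover have "(\<Prod>y\<in>UNIV - {0 :: 'a}. y) \<noteq> 0"
    by simp
  ultimately show ?thesis
    by simp
qed

lemma card_roots_unity_finite_field:
  assumes "n dvd CARD('a::{field,finite}) - 1"
  shows "card {x :: 'a. x ^ n = 1} = n"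
proof -
  obtain e where e: "CARD('a) - 1 = n * e"
    using assms by (rule dvdE)
  then have n_pos: "n > 0" and e_pos: "e > 0"
    using two_le_CARD_field[where 'a = 'a] by (auto intro!: gr0I)
  let ?R = "{x :: 'a. x ^ n = 1}" and ?S = "{x :: 'a. (\<Sum>i<e. x ^ (n * i)) = 0}"
  have "UNIV - {0} \<subseteq> ?R \<union> ?S"
  proof
    fix x :: 'a
    assume "x \<in> UNIV - {0}"
    then have "(x ^ n) ^ e = 1"
      using power_CARD_minus_one_eq_one[of x] e by (simp flip: power_mult)
    then have "(x ^ n - 1) * (\<Sum>i<e. (x ^ n) ^ i) = 0"
      by (simp flip: power_diff_1_eq)
    then show "x \<in> ?R \<union> ?S"
      by (auto simp: power_mult)
  qed
  then have "CARD('a) - 1 \<le> card (?R \<union> ?S)"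
    using card_mono[of "?R \<union> ?S" "UNIV - {0}"] by (simp add: card_Diff_singleton)
  also have "\<dots> \<le> card ?R + card ?S"
    by (rule card_Un_le)
  also have "card ?S \<le> n * (e - 1)"
    using n_pos e_pos by (intro card_roots_sum_powers) (auto simp: inj_on_def)
  also have "n * (e - 1) = CARD('a) - 1 - n"
    unfolding e by (simp add: diff_mult_distrib2)
  finally have "CARD('a) - 1 \<le> card ?R + (CARD('a) - 1 - n)"
    by simp
  moreover have "n \<le> CARD('a) - 1"
    using e e_pos by simp
  ultimately show ?thesis
    using card_roots_unity_idom[OF n_pos, where 'a = 'a] by linarith
qed

lemma GF_eq_insert_roots_unity:
  assumes "Q > 1"
  shows "GF Q = insert (0 :: 'a::field) {x. x ^ (Q - 1) = 1}"
proof -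
  obtain n where "Q = Suc n"
    using assms by (cases Q) auto
  with assms show ?thesis
    by (auto simp: GF_def)
qed

lemma card_GF_le:
  assumes "Q > 1"
  shows "card (GF Q :: 'a::field set) \<le> Q"
proof -
  have "card (GF Q :: 'a set) \<le> Suc (card {x :: 'a. x ^ (Q - 1) = 1})"
    unfolding GF_eq_insert_roots_unity[OF assms] by (rule card_insert_le_m1) auto
  also have "\<dots> \<le> Q"
    using card_roots_unity_idom[of "Q - 1", where 'a = 'a] assms by simp
  finally show ?thesis .
qed

lemma card_GF:
  assumes "CARD('a::{field,finite}) = Q ^ d" "Q > 1"
  shows "card (GF Q :: 'a set) = Q"
proof -
  have "[Q ^ d = 1 ^ d] (mod Q - 1)"
    using assms(2) by (intro cong_pow) (simp add: cong_altdef_nat)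
  then have "Q - 1 dvd CARD('a) - 1"
    using assms by (simp add: cong_altdef_nat)
  then have "card {x :: 'a. x ^ (Q - 1) = 1} = Q - 1"
    by (rule card_roots_unity_finite_field)
  then show ?thesis
    using assms(2) by (simp add: GF_eq_insert_roots_unity card_insert_if power_0_left)
qed

lemma prime_CHAR_finite_field: "prime CHAR('a::{field,finite})"
  by (rule prime_CHAR_semidom) (simp add: finite_imp_CHAR_pos)

lemma CHAR_eq_of_CARD_prime_power:
  assumes "prime p" "CARD('a::{field,finite}) = p ^ k"
  shows "CHAR('a) = p"
proof -
  have "CHAR('a) dvd p ^ k"
    using CHAR_dvd_CARD[where 'a = 'a] by (simp add: assms(2))
  with assms(1) show ?thesis
    using prime_CHAR_finite_field[where 'a = 'a] prime_dvd_power primes_dvd_imp_eq by blast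
qed

lemma of_nat_image_eq_GF_CHAR:
  "of_nat ` {..<CHAR('a)} = (GF CHAR('a) :: 'a::{field,finite} set)"
proof (rule card_seteq)
  have "of_nat n ^ CHAR('a) = (of_nat n :: 'a)" for n
    using prime_gt_0_nat[OF prime_CHAR_finite_field[where 'a = 'a]]
    by (induction n) (simp_all add: power_0_left freshmans_dream prime_CHAR_finite_field)
  then show "of_nat ` {..<CHAR('a)} \<subseteq> (GF CHAR('a) :: 'a set)"
    by (auto simp: GF_def)
  have "inj_on (of_nat :: nat \<Rightarrow> 'a) {..<CHAR('a)}"
    by (intro inj_onI) (auto simp: of_nat_eq_iff_cong_CHAR cong_def)
  then show "card (GF CHAR('a) :: 'a set) \<le> card (of_nat ` {..<CHAR('a)} :: 'a set)"
    using card_GF_le[OF prime_gt_1_nat[OF prime_CHAR_finite_field[where 'a = 'a]], where 'a = 'a]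
    by (simp add: card_image)
qed simp

section \<open>Primitive elements and cyclotomic classes\<close>

lemma primitive_element_nonzero:
  assumes "primitive_element \<omega>"
  shows "\<omega> \<noteq> 0"
proof -
  have "\<omega> ^ 1 \<in> UNIV - {0}"
    using assms unfolding primitive_element_def by blast
  then show ?thesis
    by simp
qed

lemma primitive_element_power_eq_1_iff:
  fixes \<omega> :: "'a::{field,finite}"
  assumes "primitive_element \<omega>"
  shows "\<omega> ^ k = 1 \<longleftrightarrow> CARD('a) - 1 dvd k"
proof -
  define N where "N = CARD('a) - 1"
  have N: "N > 0"
    using two_le_CARD_field[where 'a = 'a] by (simp add: N_def)
  have "\<omega> ^ N = 1"
    unfolding N_def by (intro power_CARD_minus_one_eq_one primitive_element_nonzero assms)
  then have "\<omega> ^ (N * (j div N) + j mod N) = \<omega> ^ (j mod N)" for j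
    by (simp only: power_add power_mult power_one mult_1)
  then have reduce: "\<omega> ^ j = \<omega> ^ (j mod N)" for j
    by simp
  have "range (\<lambda>k. \<omega> ^ k) \<subseteq> (\<lambda>k. \<omega> ^ k) ` {..<N}"
    by (intro image_subsetI, subst reduce) (use N in simp)
  then have "(\<lambda>k. \<omega> ^ k) ` {..<N} = range (\<lambda>k. \<omega> ^ k)"
    by auto
  also have "\<dots> = UNIV - {0}"
    using assms by (simp only: primitive_element_def)
  finally have "inj_on (\<lambda>k. \<omega> ^ k) {..<N}"
    by (intro eq_card_imp_inj_on) (simp_all add: N_def card_Diff_singleton)
  then have "\<omega> ^ (k mod N) = \<omega> ^ 0 \<longleftrightarrow> k mod N = 0"
    using N by (intro inj_on_eq_iff) auto
  then show ?thesis
    using reduce[of k] by (auto simp: N_def)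
qed

lemma primitive_element_powi_eq_1_iff:
  fixes \<omega> :: "'a::{field,finite}"
  assumes "primitive_element \<omega>"
  shows "\<omega> powi j = 1 \<longleftrightarrow> int (CARD('a) - 1) dvd j"
  by (cases j rule: int_cases2)
    (simp_all only: power_int_minus power_int_of_nat inverse_eq_1_iff dvd_minus_iff of_nat_dvd_iff
      primitive_element_power_eq_1_iff[OF assms])

context
  fixes \<omega> :: "'a::{field,finite}" and e Q :: nat
  assumes primitive: "primitive_element \<omega>" and index: "e * (Q - 1) = CARD('a) - 1" and Q: "Q > 1"
begin

lemma primitive_element_powi_in_GF_iff: "\<omega> powi j \<in> GF Q \<longleftrightarrow> int e dvd j"
proof -
  have "\<omega> powi j \<in> GF Q \<longleftrightarrow> \<omega> powi (j * int (Q - 1)) = 1"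
    using primitive_element_nonzero[OF primitive]
    unfolding GF_eq_insert_roots_unity[OF Q] by (simp add: power_int_power')
  also have "\<dots> \<longleftrightarrow> int e * int (Q - 1) dvd j * int (Q - 1)"
    by (simp only: primitive_element_powi_eq_1_iff[OF primitive] flip: index of_nat_mult)
  also have "\<dots> \<longleftrightarrow> int e dvd j"
    using Q by (intro dvd_times_right_cancel_iff) simp
  finally show ?thesis .
qed

lemma nonzero_squares_GF_eq:
  "nonzero_squares (GF Q) = {\<omega> powi (2 * int e * k) | k. True}"
proof (intro equalityI subsetI)
  fix x :: 'a
  assume "x \<in> nonzero_squares (GF Q)"
  then obtain y where y: "x = y ^ 2" "y \<in> GF Q" "y \<noteq> 0"
    unfolding nonzero_squares_def by blast
  then obtain j :: nat where j: "y = \<omega> powi int j"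
    using primitive unfolding primitive_element_def power_int_of_nat by blast
  with y(2) have "int e dvd int j"
    by (simp only: primitive_element_powi_in_GF_iff)
  then obtain k where "int j = int e * k"
    by (rule dvdE)
  with y(1) j show "x \<in> {\<omega> powi (2 * int e * k) | k. True}"
    by (auto simp: power_int_power' mult_ac)
next
  fix x :: 'a
  assume "x \<in> {\<omega> powi (2 * int e * k) | k. True}"
  then obtain k where "x = (\<omega> powi (int e * k)) ^ 2"
    by (auto simp: power_int_power' mult_ac)
  moreover have "\<omega> powi (int e * k) \<in> GF Q"
    by (simp add: primitive_element_powi_in_GF_iff)
  moreover have "\<omega> powi (int e * k) \<noteq> 0"
    using primitive_element_nonzero[OF primitive] by simp
  ultimately show "x \<in> nonzero_squares (GF Q)"
    unfolding nonzero_squares_def by blast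
qed

lemma cyclotomic_class_eq_image_nonzero_squares:
  "cyclotomic_class \<omega> (2 * int e) i = (\<lambda>c. \<omega> powi i * c) ` nonzero_squares (GF Q)"
  unfolding cyclotomic_class_def nonzero_squares_GF_eq by (auto simp: power_int_mult)

lemma primitive_element_power_not_square:
  assumes "odd Q"
  shows "\<omega> ^ e \<notin> nonzero_squares (GF Q)"
proof
  assume "\<omega> ^ e \<in> nonzero_squares (GF Q)"
  then obtain k where "\<omega> powi int e = \<omega> powi (2 * int e * k)"
    unfolding nonzero_squares_GF_eq power_int_of_nat by blast
  then have "\<omega> powi (2 * int e * k - int e) = 1"
    using primitive_element_nonzero[OF primitive] by (simp add: power_int_diff)
  then have "int e * int (Q - 1) dvd 2 * int e * k - int e"
    by (simp only: primitive_element_powi_eq_1_iff[OF primitive] flip: index of_nat_mult)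
  also have "2 * int e * k - int e = int e * (2 * k - 1)"
    by (simp add: algebra_simps)
  finally have "int (Q - 1) dvd 2 * k - 1"
    using index two_le_CARD_field[where 'a = 'a] by (cases e) (auto simp del: of_nat_Suc)
  moreover have "2 dvd int (Q - 1)"
    using assms by simp
  ultimately have "2 dvd 2 * k - 1"
    by (rule dvd_trans[rotated])
  then show False
    by simp
qed

end

section \<open>Additive characters of a subfield\<close>

locale finite_subfield =
  fixes p f q d :: nat and K :: "'a::{field,finite} set"
  assumes prime_p: "prime p" and f_pos: "f > 0" and q_eq: "q = p ^ f"
    and K_eq: "K = GF q" and CARD_eq: "CARD('a) = q ^ d"
begin

lemma q_gt_1: "q > 1"
  using prime_gt_1_nat[OF prime_p] f_pos unfolding q_eq by (rule one_less_power)

lemma CHAR_eq: "CHAR('a) = p"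
  by (rule CHAR_eq_of_CARD_prime_power[OF prime_p]) (simp add: CARD_eq q_eq flip: power_mult)

lemma power_p_power_add: "(x + y :: 'a) ^ (p ^ k) = x ^ (p ^ k) + y ^ (p ^ k)"
  by (rule freshmans_dream'[of _ k]) (simp_all add: CHAR_eq prime_p)

lemma power_q_add: "(x + y :: 'a) ^ q = x ^ q + y ^ q"
  unfolding q_eq by (rule power_p_power_add)

lemma power_q_minus: "(- x :: 'a) ^ q = - (x ^ q)"
  using power_q_add[of x "- x"] q_gt_1 by (simp add: power_0_left add_eq_0_iff)

lemma power_q_diff: "(x - y :: 'a) ^ q = x ^ q - y ^ q"
  using power_q_add[of x "- y"] by (simp add: power_q_minus)

lemma K_iff: "x \<in> K \<longleftrightarrow> x ^ q = x"
  by (simp add: K_eq GF_def)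

lemma K_closed [simp, intro]:
  "0 \<in> K" "1 \<in> K"
  "x \<in> K \<Longrightarrow> y \<in> K \<Longrightarrow> x + y \<in> K"
  "x \<in> K \<Longrightarrow> y \<in> K \<Longrightarrow> x - y \<in> K"
  "x \<in> K \<Longrightarrow> y \<in> K \<Longrightarrow> x * y \<in> K"
  "x \<in> K \<Longrightarrow> y \<in> K \<Longrightarrow> x / y \<in> K"
  "x \<in> K \<Longrightarrow> - x \<in> K"
  using q_gt_1
  by (auto simp: K_iff power_q_add power_q_diff power_q_minus power_mult_distrib power_divide
      power_0_left)

lemma card_K: "card K = q"
  unfolding K_eq by (rule card_GF[OF CARD_eq q_gt_1])

lemma card_K_nonzero: "card (K - {0}) = q - 1"
  by (simp add: card_Diff_singleton card_K)

lemma power_q_minus_1_eq_1: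
  assumes "x \<in> K" "x \<noteq> 0"
  shows "x ^ (q - 1) = 1"
  using assms by (simp add: K_eq GF_eq_insert_roots_unity[OF q_gt_1])

lemma sum_K_nonzero_mult:
  assumes "c \<in> K" "c \<noteq> 0"
  shows "(\<Sum>x\<in>K - {0}. F (c * x)) = (\<Sum>x\<in>K - {0}. F x)"
  by (rule sum.reindex_bij_witness[of _ "\<lambda>y. y / c" "\<lambda>y. c * y"]) (use assms in auto)

lemma sum_K_mult:
  assumes "c \<in> K" "c \<noteq> 0"
  shows "(\<Sum>x\<in>K. F (c * x)) = (\<Sum>x\<in>K. F x)"
  using sum_K_nonzero_mult[OF assms, of F] by (simp add: sum.remove[of K 0])

lemma sum_K_diff:
  assumes "c \<in> K"
  shows "(\<Sum>x\<in>K. F (x - c)) = (\<Sum>x\<in>K. F x)"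
  by (rule sum.reindex_bij_witness[of _ "\<lambda>y. y + c" "\<lambda>y. y - c"]) (use assms in auto)

abbreviation \<psi> :: "'a \<Rightarrow> complex" where "\<psi> \<equiv> add_char p f"

lemma abs_trace_add: "abs_trace p f (x + y :: 'a) = abs_trace p f x + abs_trace p f y"
  by (simp add: abs_trace_def power_p_power_add sum.distrib)

lemma abs_trace_in_prime_field:
  assumes "x \<in> K"
  shows "abs_trace p f x \<in> GF p"
proof -
  have "abs_trace p f x ^ p = (\<Sum>i<f. (x ^ (p ^ i)) ^ p)"
    unfolding abs_trace_def by (rule freshmans_dream_sum) (simp_all add: CHAR_eq prime_p)
  also have "\<dots> = (\<Sum>i<f. x ^ (p ^ Suc i))"
    by (simp add: mult.commute flip: power_mult)
  also have "\<dots> + x = (\<Sum>i<Suc f. x ^ (p ^ i))"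
    by (subst sum.lessThan_Suc_shift) simp
  also have "\<dots> = abs_trace p f x + x"
    using assms by (simp add: abs_trace_def K_iff q_eq)
  finally show ?thesis
    by (simp add: GF_def)
qed

lemma ex1_of_nat_eq_abs_trace:
  assumes "x \<in> K"
  shows "\<exists>!n. n < p \<and> of_nat n = abs_trace p f x"
proof -
  obtain n where "n < p" "of_nat n = abs_trace p f x"
    using abs_trace_in_prime_field[OF assms]
    by (auto simp flip: of_nat_image_eq_GF_CHAR[where 'a = 'a, unfolded CHAR_eq])
  then show ?thesis
    by (metis CHAR_eq cong_less_modulus_unique_nat of_nat_eq_iff_cong_CHAR)
qed

lemma add_char_eq_exp:
  assumes "x \<in> K" "of_nat n = abs_trace p f x"
  shows "\<psi> x = exp (2 * of_real pi * \<i> * of_nat n / of_nat p)"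
proof -
  have "p > 0"
    using prime_p by (rule prime_gt_0_nat)
  moreover have "of_nat (n mod p) = (of_nat n :: 'a)"
    by (simp add: of_nat_eq_iff_cong_CHAR CHAR_eq)
  ultimately have "(THE n. n < p \<and> of_nat n = abs_trace p f x) = n mod p"
    using assms by (intro the1_equality ex1_of_nat_eq_abs_trace) auto
  with \<open>p > 0\<close> show ?thesis
    by (simp add: add_char_def complex_root_unity_eq)
qed

lemma add_char_add:
  assumes "x \<in> K" "y \<in> K"
  shows "\<psi> (x + y) = \<psi> x * \<psi> y"
proof -
  obtain m n where mn: "of_nat m = abs_trace p f x" "of_nat n = abs_trace p f y"
    using ex1_of_nat_eq_abs_trace assms by metis
  then have "of_nat (m + n) = abs_trace p f (x + y)"
    by (simp add: abs_trace_add)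
  then show ?thesis
    using assms mn
    by (simp add: add_char_eq_exp[of _ "m + n"] add_char_eq_exp[of _ m] add_char_eq_exp[of _ n]
        add_divide_distrib distrib_left flip: exp_add)
qed

lemma add_char_0: "\<psi> 0 = 1"
proof -
  have "abs_trace p f (0 :: 'a) = 0"
    using prime_gt_0_nat[OF prime_p] by (simp add: abs_trace_def power_0_left)
  then show ?thesis
    using add_char_eq_exp[of 0 0] by simp
qed

text \<open>The trace is a polynomial of degree \<open>p ^ (f - 1) < q\<close>, so it does not vanish on all of \<open>K\<close>.\<close>

lemma add_char_nontrivial: "\<exists>a\<in>K. \<psi> a \<noteq> 1"
proof -
  have "p > 1"
    using prime_p by (rule prime_gt_1_nat)
  have "\<not> K \<subseteq> {x. abs_trace p f x = 0}"
  proof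
    assume "K \<subseteq> {x. abs_trace p f x = 0}"
    then have "q \<le> card {x :: 'a. (\<Sum>i<f. x ^ (p ^ i)) = 0}"
      unfolding card_K[symmetric] abs_trace_def by (intro card_mono) auto
    also have "\<dots> \<le> p ^ (f - 1)"
      using \<open>p > 1\<close> f_pos by (intro card_roots_sum_powers) (auto simp: inj_on_def)
    also have "\<dots> < q"
      using \<open>p > 1\<close> f_pos by (simp add: q_eq)
    finally show False
      by simp
  qed
  then obtain a where a: "a \<in> K" "abs_trace p f a \<noteq> 0"
    by blast
  then obtain n where n: "n < p" "of_nat n = abs_trace p f a"
    using ex1_of_nat_eq_abs_trace by blast
  with a(2) have "n \<noteq> 0"
    by (metis of_nat_0)
  then have "\<psi> a \<noteq> 1"
    using n \<open>p > 1\<close> complex_root_unity_eq[of p n 0] add_char_eq_exp[OF a(1) n(2)] by simp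
  with a(1) show ?thesis ..
qed

lemma sum_add_char:
  assumes c: "c \<in> K"
  shows "(\<Sum>x\<in>K. \<psi> (x * c)) = (if c = 0 then of_nat q else 0)"
proof (cases "c = 0")
  case False
  obtain a where a: "a \<in> K" "\<psi> a \<noteq> 1"
    using add_char_nontrivial by blast
  have "(\<Sum>x\<in>K. \<psi> (x * c)) = (\<Sum>x\<in>K. \<psi> x)"
    using sum_K_mult[OF c False] by (simp add: mult.commute)
  moreover have "(\<Sum>x\<in>K. \<psi> x) = (\<Sum>x\<in>K. \<psi> (x - a))"
    by (rule sum_K_diff[OF a(1), symmetric])
  moreover have "(\<Sum>x\<in>K. \<psi> (x - a)) * \<psi> a = (\<Sum>x\<in>K. \<psi> x)"
    using a(1) by (simp add: sum_distrib_right flip: add_char_add)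
  ultimately show ?thesis
    using a(2) False by simp
qed (simp add: add_char_0 card_K)

end

section \<open>The quadratic character and its Gauss sum\<close>

locale odd_finite_subfield = finite_subfield p f q d K
  for p f q d :: nat and K :: "'a::{field,finite} set" +
  assumes odd_q: "odd q"
begin

abbreviation \<eta> :: "'a \<Rightarrow> complex" where "\<eta> \<equiv> quadratic_char K"
abbreviation G :: complex where "G \<equiv> gauss_sum p f \<eta>"

lemma two_mult_half_q_minus_1: "2 * ((q - 1) div 2) = q - 1"
  using odd_q by simp

lemma nonzero_squares_subset: "nonzero_squares K \<subseteq> K - {0}"
  by (auto simp: nonzero_squares_def power2_eq_square)

lemma card_nonzero_squares_ge: "(q - 1) div 2 \<le> card (nonzero_squares K)"
proof -
  have "K - {0} = (\<Union>s\<in>nonzero_squares K. {y \<in> K - {0}. y ^ 2 = s})"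
    by (auto simp: nonzero_squares_def)
  then have "q - 1 = card (\<Union>s\<in>nonzero_squares K. {y \<in> K - {0}. y ^ 2 = s})"
    by (simp only: card_K_nonzero)
  also have "\<dots> \<le> (\<Sum>s\<in>nonzero_squares K. card {y \<in> K - {0}. y ^ 2 = s})"
    by (rule card_UN_le) simp
  also have "\<dots> \<le> (\<Sum>s\<in>nonzero_squares K. 2)"
  proof (rule sum_mono)
    fix s
    assume "s \<in> nonzero_squares K"
    then obtain z where "s = z ^ 2"
      by (auto simp: nonzero_squares_def)
    then have "card {y \<in> K - {0}. y ^ 2 = s} \<le> card {z, - z}"
      by (intro card_mono) (auto simp: power2_eq_iff)
    also have "\<dots> \<le> 2"
      by (simp add: card_insert_if)
    finally show "card {y \<in> K - {0}. y ^ 2 = s} \<le> 2" .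
  qed
  finally show ?thesis
    by simp
qed

lemma euler_criterion: "nonzero_squares K = {x \<in> K. x ^ ((q - 1) div 2) = 1}"
proof (rule card_seteq)
  show "nonzero_squares K \<subseteq> {x \<in> K. x ^ ((q - 1) div 2) = 1}"
  proof
    fix x
    assume "x \<in> nonzero_squares K"
    then obtain y where "x = y ^ 2" "y \<in> K" "y \<noteq> 0"
      by (auto simp: nonzero_squares_def)
    moreover from this have "x ^ ((q - 1) div 2) = y ^ (q - 1)"
      by (simp only: two_mult_half_q_minus_1 flip: power_mult)
    ultimately show "x \<in> {x \<in> K. x ^ ((q - 1) div 2) = 1}"
      using power_q_minus_1_eq_1[of y] by (simp add: power2_eq_square)
  qed
  have "card {x \<in> K. x ^ ((q - 1) div 2) = 1} \<le> card {x :: 'a. x ^ ((q - 1) div 2) = 1}"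
    by (intro card_mono) auto
  also have "\<dots> \<le> (q - 1) div 2"
    using two_mult_half_q_minus_1 q_gt_1 by (intro card_roots_unity_idom) linarith
  finally show "card {x \<in> K. x ^ ((q - 1) div 2) = 1} \<le> card (nonzero_squares K)"
    using card_nonzero_squares_ge by linarith
qed simp

lemma power_half_cases:
  assumes "x \<in> K" "x \<noteq> 0"
  shows "x ^ ((q - 1) div 2) = 1 \<or> x ^ ((q - 1) div 2) = - 1"
proof -
  have "(x ^ ((q - 1) div 2)) ^ 2 = 1"
    using power_q_minus_1_eq_1[OF assms] two_mult_half_q_minus_1 by (metis mult.commute power_mult)
  then show ?thesis
    by (simp add: power2_eq_1_iff)
qed

lemma one_neq_minus_one: "(1 :: 'a) \<noteq> - 1"
proof
  assume "(1 :: 'a) = - 1"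
  then have "of_nat 2 = (0 :: 'a)"
    by (simp add: eq_neg_iff_add_eq_0)
  then have "p dvd 2"
    by (simp only: of_nat_eq_0_iff_char_dvd CHAR_eq)
  then have "p = 2"
    by (rule primes_dvd_imp_eq[OF prime_p two_is_prime_nat])
  then show False
    using odd_q f_pos by (simp add: q_eq)
qed

lemma quadratic_char_0 [simp]: "\<eta> 0 = 0"
  by (simp add: quadratic_char_def)

lemma quadratic_char_cases: "x \<noteq> 0 \<Longrightarrow> \<eta> x = 1 \<or> \<eta> x = - 1"
  by (simp add: quadratic_char_def)

lemma nonzero_squares_iff: "x \<in> nonzero_squares K \<longleftrightarrow> x \<in> K \<and> \<eta> x = 1"
  using nonzero_squares_subset by (auto simp: quadratic_char_def)

lemma quadratic_char_mult:
  assumes "x \<in> K" "y \<in> K"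
  shows "\<eta> (x * y) = \<eta> x * \<eta> y"
proof (cases "x = 0 \<or> y = 0")
  case False
  then show ?thesis
    using assms power_half_cases[of x] power_half_cases[of y] one_neq_minus_one
    by (auto simp: quadratic_char_def euler_criterion power_mult_distrib)
qed auto

lemma quadratic_char_inverse:
  assumes "x \<in> K"
  shows "\<eta> (1 / x) = \<eta> x"
proof (cases "x = 0")
  case False
  then have "\<eta> (1 / x) * \<eta> x = \<eta> 1"
    using assms by (simp flip: quadratic_char_mult)
  also have "\<eta> 1 = 1"
    using euler_criterion by (simp add: quadratic_char_def)
  finally show ?thesis
    using quadratic_char_cases[OF False] by (auto simp: minus_equation_iff)
qed simp

lemma quadratic_char_mult_self:
  assumes "x \<noteq> 0"
  shows "\<eta> x * \<eta> x = 1"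
  using quadratic_char_cases[OF assms] by auto

lemma minus_one_square:
  assumes "4 dvd q - 1"
  shows "- 1 \<in> nonzero_squares K"
proof -
  have "even ((q - 1) div 2)"
    using assms by presburger
  then show ?thesis
    by (simp add: euler_criterion)
qed

lemma nonzero_squares_mult:
  "x \<in> nonzero_squares K \<Longrightarrow> y \<in> nonzero_squares K \<Longrightarrow> x * y \<in> nonzero_squares K"
  by (simp add: nonzero_squares_iff quadratic_char_mult)

lemma nonzero_squares_inverse: "x \<in> nonzero_squares K \<Longrightarrow> 1 / x \<in> nonzero_squares K"
  by (simp add: nonzero_squares_iff quadratic_char_inverse)

lemma ex_nonsquare: "\<exists>n\<in>K - {0}. \<eta> n = - 1"
proof (rule ccontr)
  assume "\<not> ?thesis"
  then have "K - {0} \<subseteq> {x :: 'a. x ^ ((q - 1) div 2) = 1}"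
    using quadratic_char_cases by (auto simp: euler_criterion quadratic_char_def split: if_splits)
  then have "q - 1 \<le> card {x :: 'a. x ^ ((q - 1) div 2) = 1}"
    unfolding card_K_nonzero[symmetric] by (intro card_mono) auto
  also have "\<dots> \<le> (q - 1) div 2"
    using two_mult_half_q_minus_1 q_gt_1 by (intro card_roots_unity_idom) linarith
  finally show False
    using q_gt_1 by linarith
qed

lemma sum_quadratic_char: "(\<Sum>x\<in>K. \<eta> x) = 0"
proof -
  obtain n where n: "n \<in> K" "n \<noteq> 0" "\<eta> n = - 1"
    using ex_nonsquare by blast
  then have "(\<Sum>x\<in>K. \<eta> x) = (\<Sum>x\<in>K. \<eta> (n * x))"
    by (intro sum_K_mult[symmetric])
  also have "\<dots> = - (\<Sum>x\<in>K. \<eta> x)"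
    using n by (simp add: quadratic_char_mult sum_negf)
  finally show ?thesis
    by simp
qed

lemma sum_quadratic_char_diff: "s \<in> K \<Longrightarrow> (\<Sum>x\<in>K. \<eta> (x - s)) = 0"
  using sum_K_diff[of s \<eta>] sum_quadratic_char by simp

lemma gauss_sum_eq_sum_K: "G = (\<Sum>x\<in>K. \<eta> x * \<psi> x)"
  unfolding gauss_sum_def K_eq[unfolded q_eq, symmetric]
  by (rule sum.mono_neutral_left) auto

lemma gauss_sum_square: "G ^ 2 = \<eta> (- 1) * of_nat q"
proof -
  let ?K' = "K - {0}"
  have substitute: "(\<Sum>y\<in>?K'. \<eta> x * \<psi> x * (\<eta> y * \<psi> y)) = (\<Sum>t\<in>?K'. \<eta> t * \<psi> (x * (1 + t)))"
    if x: "x \<in> ?K'" for x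
  proof -
    have "(\<Sum>y\<in>?K'. \<eta> x * \<psi> x * (\<eta> y * \<psi> y)) = (\<Sum>t\<in>?K'. \<eta> x * \<psi> x * (\<eta> (x * t) * \<psi> (x * t)))"
      using x by (intro sum_K_nonzero_mult[symmetric]) auto
    also have "\<dots> = (\<Sum>t\<in>?K'. \<eta> x * \<eta> x * \<eta> t * \<psi> (x * (1 + t)))"
      using x by (intro sum.cong) (simp_all add: quadratic_char_mult distrib_left add_char_add)
    finally show ?thesis
      using x by (simp add: quadratic_char_mult_self)
  qed
  have orthogonality: "(\<Sum>x\<in>?K'. \<psi> (x * (1 + t))) = (if t = - 1 then of_nat q else 0) - 1"
    if "t \<in> K" for t
    using that sum_add_char[of "1 + t"] by (simp add: sum_diff1 add_char_0 add_eq_0_iff)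
  have "G ^ 2 = (\<Sum>x\<in>?K'. \<Sum>y\<in>?K'. \<eta> x * \<psi> x * (\<eta> y * \<psi> y))"
    by (simp add: power2_eq_square gauss_sum_def sum_product K_eq q_eq)
  also have "\<dots> = (\<Sum>x\<in>?K'. \<Sum>t\<in>?K'. \<eta> t * \<psi> (x * (1 + t)))"
    by (rule sum.cong[OF refl substitute])
  also have "\<dots> = (\<Sum>t\<in>?K'. \<Sum>x\<in>?K'. \<eta> t * \<psi> (x * (1 + t)))"
    by (rule sum.swap)
  also have "\<dots> = (\<Sum>t\<in>?K'. (if t = - 1 then \<eta> t * of_nat q else 0) - \<eta> t)"
  proof (intro sum.cong refl)
    fix t
    assume t: "t \<in> ?K'"
    have "(\<Sum>x\<in>?K'. \<eta> t * \<psi> (x * (1 + t))) = \<eta> t * ((if t = - 1 then of_nat q else 0) - 1)"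
      using t by (simp only: orthogonality DiffD1 flip: sum_distrib_left)
    then show "(\<Sum>x\<in>?K'. \<eta> t * \<psi> (x * (1 + t))) = (if t = - 1 then \<eta> t * of_nat q else 0) - \<eta> t"
      by (simp add: right_diff_distrib)
  qed
  also have "\<dots> = \<eta> (- 1) * of_nat q"
    by (simp add: sum_subtractf sum_diff1 sum_quadratic_char)
  finally show ?thesis .
qed

lemma gauss_sum_nonzero: "G \<noteq> 0"
  using gauss_sum_square q_gt_1 quadratic_char_cases[of "- 1"] by auto

end

section \<open>Functions transforming by the quadratic character\<close>

definition signed_indicator :: "'a::zero set \<Rightarrow> 'a \<Rightarrow> complex" where
  "signed_indicator S z = (if z = 0 then 0 else if z \<in> S then 1 else - 1)"

lemma signed_indicator_cases:
  "z \<noteq> 0 \<Longrightarrow> signed_indicator S z = 1 \<or> signed_indicator S z = - 1"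
  by (simp add: signed_indicator_def)

lemma signed_indicator_complement:
  assumes "A \<union> B = UNIV - {0}" "A \<inter> B = {}"
  shows "signed_indicator B = (\<lambda>z. - signed_indicator A z)"
  using assms by (auto simp: signed_indicator_def fun_eq_iff)

context odd_finite_subfield
begin

definition homogeneous :: "('a \<Rightarrow> complex) \<Rightarrow> bool" where
  "homogeneous h \<longleftrightarrow> (\<forall>c\<in>K. \<forall>z. h (c * z) = \<eta> c * h z)"

lemma homogeneousD: "homogeneous h \<Longrightarrow> c \<in> K \<Longrightarrow> h (c * z) = \<eta> c * h z"
  by (simp add: homogeneous_def)

definition line_sum :: "('a \<Rightarrow> complex) \<Rightarrow> 'a \<Rightarrow> 'a \<Rightarrow> complex" where
  "line_sum h u v = (\<Sum>y\<in>K. h (u + y * v))"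

lemma line_sum_scaled_base:
  assumes h: "homogeneous h" and t: "t \<in> K"
  shows "line_sum h (t * u) v = \<eta> t * line_sum h u v"
proof (cases "t = 0")
  case True
  have "(\<Sum>y\<in>K. h (y * v)) = (\<Sum>y\<in>K. \<eta> y) * h v"
    using h by (simp add: homogeneousD sum_distrib_right)
  with True show ?thesis
    by (simp add: line_sum_def sum_quadratic_char)
next
  case False
  have "line_sum h (t * u) v = (\<Sum>y\<in>K. h (t * u + (t * y) * v))"
    unfolding line_sum_def using t False by (intro sum_K_mult[symmetric])
  also have "\<dots> = (\<Sum>y\<in>K. h (t * (u + y * v)))"
    by (simp add: algebra_simps)
  finally show ?thesis
    using h t by (simp add: line_sum_def homogeneousD sum_distrib_left)
qed

lemma sum_line_quadratic_char_diff:
  assumes h: "homogeneous h" and s: "s \<in> K"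
  shows "(\<Sum>x\<in>K. h (1 + x * L) * \<eta> (x - s)) = line_sum h L (1 + s * L) - h L"
proof -
  have "(\<Sum>x\<in>K. h (1 + x * L) * \<eta> (x - s)) = (\<Sum>x\<in>K - {s}. h (1 + x * L) * \<eta> (x - s))"
    by (rule sum.mono_neutral_right) auto
  also have "\<dots> = (\<Sum>y\<in>K - {0}. h (L + y * (1 + s * L)))"
  proof (rule sum.reindex_bij_witness[of _ "\<lambda>y. s + 1 / y" "\<lambda>x. 1 / (x - s)"])
    fix x
    assume x: "x \<in> K - {s}"
    define y where "y = 1 / (x - s)"
    have y: "y \<in> K" "y \<noteq> 0"
      using x s by (auto simp: y_def)
    have x_eq: "x = s + 1 / y"
      using x by (simp add: y_def)
    have "\<eta> y = \<eta> (x - s)"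
      using x s by (simp add: y_def quadratic_char_inverse)
    moreover have "y * (1 + x * L) = L + y * (1 + s * L)"
      using y by (simp add: x_eq field_simps)
    ultimately show "h (L + 1 / (x - s) * (1 + s * L)) = h (1 + x * L) * \<eta> (x - s)"
      using homogeneousD[OF h y(1), of "1 + x * L"] by (simp add: mult.commute flip: y_def)
  qed (use s in auto)
  also have "\<dots> = line_sum h L (1 + s * L) - h L"
    by (simp add: sum_diff1 line_sum_def)
  finally show ?thesis .
qed

lemma nonzero_squares_mult_mem_iff:
  assumes square_mult: "\<And>c z. c \<in> nonzero_squares K \<Longrightarrow> z \<in> S \<Longrightarrow> c * z \<in> S"
    and a: "a \<in> nonzero_squares K"
  shows "a * x \<in> S \<longleftrightarrow> x \<in> S"
proof
  assume "a * x \<in> S"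
  then have "1 / a * (a * x) \<in> S"
    by (rule square_mult[OF nonzero_squares_inverse[OF a]])
  moreover have "a \<noteq> 0"
    using a nonzero_squares_subset by blast
  ultimately show "x \<in> S"
    by simp
qed (rule square_mult[OF a])

lemma homogeneous_signed_indicator:
  assumes n: "n \<in> K" "\<eta> n = - 1"
    and square_mult: "\<And>c z. c \<in> nonzero_squares K \<Longrightarrow> z \<in> S \<Longrightarrow> c * z \<in> S"
    and nonsquare_mult: "\<And>z. z \<noteq> 0 \<Longrightarrow> n * z \<in> S \<longleftrightarrow> z \<notin> S"
  shows "homogeneous (signed_indicator S)"
  unfolding homogeneous_def
proof (intro ballI allI)
  fix c z
  assume c: "c \<in> K"
  have square_mult_iff: "a * x \<in> S \<longleftrightarrow> x \<in> S" if "a \<in> nonzero_squares K" for a x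
    using square_mult that by (rule nonzero_squares_mult_mem_iff)
  show "signed_indicator S (c * z) = \<eta> c * signed_indicator S z"
  proof (cases "c = 0 \<or> z = 0")
    case False
    then consider (square) "\<eta> c = 1" | (nonsquare) "\<eta> c = - 1"
      using quadratic_char_cases by blast
    then show ?thesis
    proof cases
      case square
      with c False show ?thesis
        by (simp add: signed_indicator_def square_mult_iff nonzero_squares_iff)
    next
      case nonsquare
      have n_nonzero: "n \<noteq> 0"
        using n(2) by auto
      have "\<eta> (c / n) = 1"
        using quadratic_char_mult[of c "1 / n"] c n nonsquare by (simp add: quadratic_char_inverse)
      then have "c / n * (n * z) \<in> S \<longleftrightarrow> n * z \<in> S"
        using c n(1) by (intro square_mult_iff) (simp add: nonzero_squares_iff)
      then have "c * z \<in> S \<longleftrightarrow> z \<notin> S"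
        using False n_nonzero nonsquare_mult by simp
      with nonsquare False show ?thesis
        by (simp add: signed_indicator_def)
    qed
  qed (auto simp: signed_indicator_def)
qed

section \<open>Counting by signs\<close>

lemma card_sign_positive:
  assumes "\<And>x. x \<in> K \<Longrightarrow> \<phi> x = 1 \<or> \<phi> x = (- 1 :: complex)"
  shows "2 * of_nat (card {x \<in> K. \<phi> x = 1}) = of_nat q + (\<Sum>x\<in>K. \<phi> x)"
proof -
  have "2 * of_nat (card {x \<in> K. \<phi> x = 1}) = (\<Sum>x\<in>K. 2 * of_bool (\<phi> x = 1))"
    by (simp add: Int_def flip: sum_distrib_left)
  also have "\<dots> = (\<Sum>x\<in>K. 1 + \<phi> x)"
    using assms by (intro sum.cong refl) force
  finally show ?thesis
    by (simp add: sum.distrib card_K)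
qed

lemma card_sign_positive_inter_translate:
  assumes \<phi>: "\<And>x. x \<in> K \<Longrightarrow> \<phi> x = 1 \<or> \<phi> x = (- 1 :: complex)"
    and B: "\<forall>x\<in>K. 2 * of_bool (x \<in> B) = 1 + \<sigma> * \<eta> x + \<rho> * of_bool (x = 0)"
    and s: "s \<in> K"
  shows "4 * of_nat (card ({x \<in> K. \<phi> x = 1} \<inter> translate B s))
    = of_nat q + (\<Sum>x\<in>K. \<phi> x) + \<sigma> * (\<Sum>x\<in>K. \<phi> x * \<eta> (x - s)) + \<rho> * (1 + \<phi> s)"
proof -
  have "x \<in> translate B s \<longleftrightarrow> x - s \<in> B" for x
    unfolding translate_def by (metis (no_types, lifting) add_diff_cancel diff_add_cancel image_iff)
  then have "{x \<in> K. \<phi> x = 1} \<inter> translate B s = {x \<in> K. \<phi> x = 1 \<and> x - s \<in> B}"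
    by auto
  then have "4 * of_nat (card ({x \<in> K. \<phi> x = 1} \<inter> translate B s))
      = (\<Sum>x\<in>K. (2 * of_bool (\<phi> x = 1)) * (2 * of_bool (x - s \<in> B)))"
    by (simp add: Int_def mult.assoc flip: sum_distrib_left of_bool_conj)
  also have "\<dots> = (\<Sum>x\<in>K. (1 + \<phi> x) * (1 + \<sigma> * \<eta> (x - s) + \<rho> * of_bool (x - s = 0)))"
    using \<phi> s by (intro sum.cong arg_cong2[where f = "(*)"] B[rule_format]) force+
  also have "\<dots> = (\<Sum>x\<in>K. 1 + \<phi> x + \<sigma> * \<eta> (x - s) + \<sigma> * (\<phi> x * \<eta> (x - s))
      + (if x = s then \<rho> * (1 + \<phi> x) else 0))"
    by (intro sum.cong refl) (simp add: algebra_simps)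
  also have "\<dots> = of_nat q + (\<Sum>x\<in>K. \<phi> x) + \<sigma> * (\<Sum>x\<in>K. \<phi> x * \<eta> (x - s)) + \<rho> * (1 + \<phi> s)"
    using s by (simp add: sum.distrib sum_quadratic_char_diff card_K flip: sum_distrib_left)
  finally show ?thesis .
qed

lemma of_bool_nonzero_squares:
  "\<forall>x\<in>K. 2 * of_bool (x \<in> nonzero_squares K \<union> {0}) = 1 + 1 * \<eta> x + 1 * of_bool (x = 0)"
  "\<forall>x\<in>K. 2 * of_bool (x \<in> nonzero_squares K) = 1 + 1 * \<eta> x + (- 1) * of_bool (x = 0)"
  "\<forall>x\<in>K. 2 * of_bool (x \<in> K - {0} - nonzero_squares K) = 1 + (- 1) * \<eta> x + (- 1) * of_bool (x = 0)"
  using nonzero_squares_subset by (auto simp: quadratic_char_def)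

end

section \<open>Quadratic extensions\<close>

locale quadratic_extension = odd_finite_subfield p f q 2 K
  for p f q :: nat and K :: "'a::{field,finite} set"
begin

lemma power_q_power_q [simp]: "((x :: 'a) ^ q) ^ q = x"
proof (cases "x = 0")
  case False
  have "q * q = Suc (CARD('a) - 1)"
    using two_le_CARD_field[where 'a = 'a] by (simp add: CARD_eq power2_eq_square)
  then have "(x ^ q) ^ q = x * x ^ (CARD('a) - 1)"
    by (simp only: power_Suc flip: power_mult)
  with power_CARD_minus_one_eq_one[OF False] show ?thesis
    by simp
qed (use q_gt_1 in simp)

lemma index_mult: "(q + 1) * (q - 1) = CARD('a) - 1"
  by (simp add: CARD_eq power2_eq_square algebra_simps)

abbreviation \<Psi> :: "'a \<Rightarrow> complex" where "\<Psi> \<equiv> add_char p (2 * f)"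
abbreviation \<Psi>_sum :: "'a \<Rightarrow> 'a set \<Rightarrow> complex" where "\<Psi>_sum \<equiv> add_char_sum p (2 * f)"

definition fourier :: "('a \<Rightarrow> complex) \<Rightarrow> 'a \<Rightarrow> complex" where
  "fourier h b = (\<Sum>z\<in>UNIV. h z * \<Psi> (b * z))"

lemma fourier_uminus: "fourier (\<lambda>z. - h z) b = - fourier h b"
  by (simp add: fourier_def sum_negf)

lemma add_char_extension: "\<Psi> x = \<psi> (x + x ^ q)"
proof -
  have "abs_trace p (2 * f) x = (\<Sum>i<f. x ^ (p ^ i)) + (\<Sum>i<f. x ^ (p ^ (f + i)))"
    unfolding abs_trace_def using sum.nat_group[of "\<lambda>i. x ^ (p ^ i)" f 2]
    by (simp add: numeral_2_eq_2 lessThan_Suc sum.atLeastLessThan_shift_0[of _ f] atLeast0LessThan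
        add.commute)
  also have "(\<Sum>i<f. x ^ (p ^ (f + i))) = abs_trace p f (x ^ q)"
    by (simp add: abs_trace_def q_eq power_add power_mult)
  finally have "abs_trace p (2 * f) x = abs_trace p f (x + x ^ q)"
    by (simp add: abs_trace_add) (simp add: abs_trace_def)
  then show ?thesis
    by (simp add: add_char_def)
qed

context
  fixes u v \<delta> :: 'a
  assumes \<delta>: "v ^ q * u - v * u ^ q = \<delta>" "\<delta> \<noteq> 0"
begin

lemma trace_of_coordinates:
  assumes "t \<in> K" "y \<in> K"
  defines "z \<equiv> v ^ q / \<delta> * (t * u + y * v)"
  shows "z + z ^ q = t"
proof -
  have "\<delta> ^ q = - \<delta>"
    by (simp add: power_q_diff power_mult_distrib flip: \<delta>(1))
  then have "z ^ q = - (v / \<delta> * (t * u ^ q + y * v ^ q))"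
    using assms by (simp add: z_def K_iff power_mult_distrib power_divide power_q_add)
  then have "z + z ^ q = t * (v ^ q * u - v * u ^ q) / \<delta>"
    unfolding z_def using \<delta>(2) by (simp add: field_simps)
  then show ?thesis
    using \<delta> by simp
qed

lemma bij_betw_coordinates: "bij_betw (\<lambda>(t, y). t * u + y * v) (K \<times> K) UNIV"
proof -
  have "v \<noteq> 0"
    using \<delta> q_gt_1 by (auto simp: power_0_left)
  then have inj: "inj_on (\<lambda>(t, y). t * u + y * v) (K \<times> K)"
    using trace_of_coordinates
    by (intro inj_onI) (clarsimp, metis add_left_cancel mult_right_cancel)
  moreover have "(\<lambda>(t, y). t * u + y * v) ` (K \<times> K) = UNIV"
    by (rule card_subset_eq)
      (simp_all add: card_image[OF inj] card_cartesian_product card_K CARD_eq power2_eq_square)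
  ultimately show ?thesis
    unfolding bij_betw_def ..
qed

lemma fourier_eq_gauss_sum_mult_line_sum:
  assumes h: "homogeneous h"
  shows "fourier h (v ^ q / \<delta>) = G * line_sum h u v"
proof -
  have "fourier h (v ^ q / \<delta>)
      = (\<Sum>(t, y)\<in>K \<times> K. h (t * u + y * v) * \<Psi> (v ^ q / \<delta> * (t * u + y * v)))"
    unfolding fourier_def
    by (subst sum.reindex_bij_betw[OF bij_betw_coordinates, symmetric]) (simp add: case_prod_unfold)
  also have "\<dots> = (\<Sum>(t, y)\<in>K \<times> K. h (t * u + y * v) * \<psi> t)"
    by (intro sum.cong refl)
      (auto simp: add_char_extension trace_of_coordinates simp del: times_divide_eq_left)
  also have "\<dots> = (\<Sum>t\<in>K. \<Sum>y\<in>K. h (t * u + y * v) * \<psi> t)"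
    by (rule sum.cartesian_product[symmetric])
  also have "\<dots> = (\<Sum>t\<in>K. line_sum h (t * u) v * \<psi> t)"
    by (simp add: line_sum_def sum_distrib_right)
  also have "\<dots> = (\<Sum>t\<in>K. \<eta> t * \<psi> t * line_sum h u v)"
    using h by (intro sum.cong refl) (simp add: line_sum_scaled_base)
  also have "\<dots> = G * line_sum h u v"
    by (simp add: gauss_sum_eq_sum_K sum_distrib_right)
  finally show ?thesis .
qed

end

lemma fourier_signed_indicator:
  assumes "A \<union> B = UNIV - {0}" "A \<inter> B = {}"
  shows "fourier (signed_indicator A) b = \<Psi>_sum b A - \<Psi>_sum b B"
proof -
  have "fourier (signed_indicator A) b
      = (\<Sum>z\<in>A \<union> B. signed_indicator A z * \<Psi> (b * z))"
    unfolding fourier_def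
    by (rule sum.mono_neutral_right) (auto simp: assms(1) signed_indicator_def)
  also have "\<dots> = (\<Sum>z\<in>A. signed_indicator A z * \<Psi> (b * z))
      + (\<Sum>z\<in>B. signed_indicator A z * \<Psi> (b * z))"
    using assms(2) by (intro sum.union_disjoint) auto
  also have "(\<Sum>z\<in>A. signed_indicator A z * \<Psi> (b * z)) = \<Psi>_sum b A"
    unfolding add_char_sum_def using assms(1)
    by (intro sum.cong refl) (auto simp: signed_indicator_def)
  also have "(\<Sum>z\<in>B. signed_indicator A z * \<Psi> (b * z)) = - \<Psi>_sum b B"
    unfolding add_char_sum_def sum_negf[symmetric] using assms
    by (intro sum.cong refl) (auto simp: signed_indicator_def)
  finally show ?thesis
    by simp
qed

definition fourier_pair :: "complex \<Rightarrow> 'a set \<Rightarrow> 'a set \<Rightarrow> 'a \<Rightarrow> 'a \<Rightarrow> bool" where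
  "fourier_pair M S\<^sub>0 S\<^sub>1 b z \<longleftrightarrow>
     fourier (signed_indicator S\<^sub>0) b
       = G * (M * signed_indicator S\<^sub>0 z + (1 - M) * signed_indicator S\<^sub>1 z) \<and>
     fourier (signed_indicator S\<^sub>1) b
       = G * (- (M + 1) * signed_indicator S\<^sub>0 z - M * signed_indicator S\<^sub>1 z)"

end

section \<open>Two signed sets on an affine line\<close>

lemma image_if_mem_eq_pair:
  assumes "E \<subset> A" "E \<noteq> {}"
  shows "(\<lambda>s. if s \<in> E then i else j) ` A = {i, j}"
proof -
  obtain s t where "s \<in> E" "t \<in> A - E"
    using assms by blast
  then show ?thesis
    using assms(1) by (auto simp: image_iff intro: bexI[of _ s] bexI[of _ t])
qed

text \<open>
  The two values of \<open>\<delta>\<close> below are those of \<open>v ^ q * u - v * u ^ q\<close> for the lines \<open>1 + K * L\<close> and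
  \<open>L + K * (1 + s * L)\<close>.
\<close>

locale signed_line_pair = quadratic_extension p f q K
  for p f q :: nat and K :: "'a::{field,finite} set" +
  fixes m :: int and L :: 'a and S\<^sub>0 S\<^sub>1 :: "'a set"
  assumes q_int: "int q = 2 * m ^ 2 - 1"
    and homogeneous_S: "homogeneous (signed_indicator S\<^sub>0)" "homogeneous (signed_indicator S\<^sub>1)"
    and L: "L \<notin> K" "L \<notin> S\<^sub>0" "L \<in> S\<^sub>1"
    and fourier_pair_S: "v \<noteq> 0 \<Longrightarrow> \<delta> \<in> {L ^ q - L, L - L ^ q} \<Longrightarrow>
      fourier_pair (of_int m) S\<^sub>0 S\<^sub>1 (v ^ q / \<delta>) v"
begin

definition D :: "'a set \<Rightarrow> 'a set" where "D S = {x \<in> K. 1 + x * L \<in> S}"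

abbreviation M :: complex where "M \<equiv> of_int m"

definition line_sign :: "'a set \<Rightarrow> 'a \<Rightarrow> complex" where
  "line_sign S x = signed_indicator S (1 + x * L)"

lemma one_plus_mult_L_nonzero:
  assumes "x \<in> K"
  shows "1 + x * L \<noteq> 0"
proof
  assume "1 + x * L = 0"
  then have "x \<noteq> 0" "x * L = - 1"
    by (auto simp: add_eq_0_iff)
  then have "L = - 1 / x"
    by (metis nonzero_mult_div_cancel_left)
  with assms L(1) show False
    by auto
qed

lemma line_sign_cases: "x \<in> K \<Longrightarrow> line_sign S x = 1 \<or> line_sign S x = - 1"
  unfolding line_sign_def by (intro signed_indicator_cases one_plus_mult_L_nonzero)

lemma D_eq_line_sign: "D S = {x \<in> K. line_sign S x = 1}"
  using one_plus_mult_L_nonzero by (auto simp: D_def line_sign_def signed_indicator_def)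

lemma signed_indicator_L: "signed_indicator S\<^sub>0 L = - 1" "signed_indicator S\<^sub>1 L = 1"
  using L by (auto simp: signed_indicator_def)

lemma line_sums:
  assumes uv: "v ^ q * u - v * u ^ q \<in> {L ^ q - L, L - L ^ q}"
  shows "line_sum (signed_indicator S\<^sub>0) u v
      = M * signed_indicator S\<^sub>0 v + (1 - M) * signed_indicator S\<^sub>1 v" (is ?sum\<^sub>0)
    and "line_sum (signed_indicator S\<^sub>1) u v
      = - (M + 1) * signed_indicator S\<^sub>0 v - M * signed_indicator S\<^sub>1 v" (is ?sum\<^sub>1)
proof -
  have \<delta>: "v ^ q * u - v * u ^ q \<noteq> 0"
    using uv L(1) by (auto simp: K_iff)
  then have "v \<noteq> 0"
    using q_gt_1 by (auto simp: power_0_left)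
  then show ?sum\<^sub>0 ?sum\<^sub>1
    using fourier_pair_S[OF \<open>v \<noteq> 0\<close> uv] gauss_sum_nonzero
      fourier_eq_gauss_sum_mult_line_sum[OF refl \<delta> homogeneous_S(1)]
      fourier_eq_gauss_sum_mult_line_sum[OF refl \<delta> homogeneous_S(2)]
    by (simp_all add: fourier_pair_def)
qed

lemma sum_line_sign: "(\<Sum>x\<in>K. line_sign S\<^sub>0 x) = 1 - 2 * M" "(\<Sum>x\<in>K. line_sign S\<^sub>1 x) = 1"
  using line_sums[of L 1] by (simp_all add: line_sign_def line_sum_def signed_indicator_L)

lemma sum_line_sign_mult_quadratic_char:
  assumes s: "s \<in> K"
  shows "(\<Sum>x\<in>K. line_sign S\<^sub>0 x * \<eta> (x - s)) = M * line_sign S\<^sub>0 s + (1 - M) * line_sign S\<^sub>1 s + 1"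
    and "(\<Sum>x\<in>K. line_sign S\<^sub>1 x * \<eta> (x - s)) = - (M + 1) * line_sign S\<^sub>0 s - M * line_sign S\<^sub>1 s - 1"
proof -
  have "(1 + s * L) ^ q * L - (1 + s * L) * L ^ q = L - L ^ q"
    using s by (simp add: K_iff power_q_add power_mult_distrib algebra_simps)
  then have "(1 + s * L) ^ q * L - (1 + s * L) * L ^ q \<in> {L ^ q - L, L - L ^ q}"
    by simp
  from line_sums[OF this] show
    "(\<Sum>x\<in>K. line_sign S\<^sub>0 x * \<eta> (x - s)) = M * line_sign S\<^sub>0 s + (1 - M) * line_sign S\<^sub>1 s + 1"
    "(\<Sum>x\<in>K. line_sign S\<^sub>1 x * \<eta> (x - s)) = - (M + 1) * line_sign S\<^sub>0 s - M * line_sign S\<^sub>1 s - 1"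
    using homogeneous_S s
    by (simp_all add: line_sign_def sum_line_quadratic_char_diff signed_indicator_L)
qed

lemma of_nat_q: "of_nat q = 2 * M ^ 2 - 1"
  using arg_cong[OF q_int, of "of_int :: int \<Rightarrow> complex"] by simp

lemma card_D: "int (card (D S\<^sub>0)) = m ^ 2 - m" "int (card (D S\<^sub>1)) = m ^ 2"
proof -
  have "2 * of_int (int (card (D S\<^sub>0))) = (2 * of_int (m ^ 2 - m) :: complex)"
    "2 * of_int (int (card (D S\<^sub>1))) = (2 * of_int (m ^ 2) :: complex)"
    using card_sign_positive[of "line_sign S\<^sub>0", OF line_sign_cases]
      card_sign_positive[of "line_sign S\<^sub>1", OF line_sign_cases] unfolding D_eq_line_sign
    by (simp_all add: sum_line_sign of_nat_q algebra_simps)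
  then show "int (card (D S\<^sub>0)) = m ^ 2 - m" "int (card (D S\<^sub>1)) = m ^ 2"
    unfolding mult_cancel_left of_int_eq_iff by simp_all
qed

lemma card_D_inter_translate:
  assumes "\<forall>x\<in>K. 2 * of_bool (x \<in> B) = 1 + \<sigma> * \<eta> x + \<rho> * of_bool (x = 0)" "s \<in> K"
  shows "4 * of_nat (card (D S \<inter> translate B s)) = of_nat q + (\<Sum>x\<in>K. line_sign S x)
    + \<sigma> * (\<Sum>x\<in>K. line_sign S x * \<eta> (x - s)) + \<rho> * (1 + line_sign S s)"
  unfolding D_eq_line_sign using line_sign_cases assms
  by (rule card_sign_positive_inter_translate)

lemma card_D_inter_translate_squares:
  assumes s: "s \<in> K"
  shows "int (card (D S\<^sub>0 \<inter> translate (nonzero_squares K \<union> {0}) s))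
      + int (card (D S\<^sub>1 \<inter> translate (nonzero_squares K) s))
    = (if s \<in> D S\<^sub>1 then m ^ 2 - m else m ^ 2)" (is "int ?a + int ?b = ?C")
proof -
  have "4 * of_int (int ?a + int ?b) = 4 * of_nat ?a + (4 * of_nat ?b :: complex)"
    by simp
  also have "\<dots> = 4 * M ^ 2 - 2 * M - 2 * M * line_sign S\<^sub>1 s"
    unfolding sum_line_sign sum_line_sign_mult_quadratic_char[OF s] of_nat_q
      card_D_inter_translate[OF of_bool_nonzero_squares(1) s]
      card_D_inter_translate[OF of_bool_nonzero_squares(2) s]
    by (simp add: algebra_simps)
  also have "\<dots> = 4 * of_int ?C"
    using line_sign_cases[OF s, of S\<^sub>1] s by (auto simp: D_eq_line_sign)
  finally show ?thesis
    by (simp only: mult_cancel_left of_int_eq_iff) simp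
qed

lemma card_D_inter_translate_nonsquares:
  assumes s: "s \<in> K"
  shows "int (card (D S\<^sub>0 \<inter> translate (nonzero_squares K) s))
      + int (card (D S\<^sub>1 \<inter> translate ((K - {0}) - nonzero_squares K) s))
    = (if s \<in> D S\<^sub>0 then m ^ 2 else m ^ 2 - m)" (is "int ?a + int ?b = ?C")
proof -
  have "4 * of_int (int ?a + int ?b) = 4 * of_nat ?a + (4 * of_nat ?b :: complex)"
    by simp
  also have "\<dots> = 4 * M ^ 2 - 2 * M + 2 * M * line_sign S\<^sub>0 s"
    unfolding sum_line_sign sum_line_sign_mult_quadratic_char[OF s] of_nat_q
      card_D_inter_translate[OF of_bool_nonzero_squares(2) s]
      card_D_inter_translate[OF of_bool_nonzero_squares(3) s]
    by (simp add: algebra_simps)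
  also have "\<dots> = 4 * of_int ?C"
    using line_sign_cases[OF s, of S\<^sub>0] s by (auto simp: D_eq_line_sign)
  finally show ?thesis
    by (simp only: mult_cancel_left of_int_eq_iff) simp
qed

lemma D_nontrivial:
  assumes "S \<in> {S\<^sub>0, S\<^sub>1}"
  shows "D S \<subset> K" "D S \<noteq> {}"
proof -
  have m: "m ^ 2 \<ge> 2"
    using q_int q_gt_1 odd_q by presburger
  then have "m \<noteq> 0" "m \<noteq> 1" "m \<noteq> - 1"
    by auto
  then have "m * (m - 1) > 0" "(m - 1) * (m + 2) \<ge> 0"
    by (auto simp: zero_less_mult_iff zero_le_mult_iff)
  then have "0 < m ^ 2 - m" "m ^ 2 - m < int q"
    unfolding q_int by (simp_all add: power2_eq_square algebra_simps)
  moreover have "0 < m ^ 2" "m ^ 2 < int q"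
    using m q_int by linarith+
  moreover have "int (card (D S)) = m ^ 2 - m \<or> int (card (D S)) = m ^ 2"
    using assms card_D by blast
  ultimately have "0 < int (card (D S))" "int (card (D S)) < int (card K)"
    unfolding card_K by linarith+
  then have "D S \<noteq> K" "D S \<noteq> {}"
    by auto
  moreover have "D S \<subseteq> K"
    by (auto simp: D_def)
  ultimately show "D S \<subset> K" "D S \<noteq> {}"
    by blast+
qed

theorem intersection_numbers:
  "{int (card (D S\<^sub>0 \<inter> translate (nonzero_squares K \<union> {0}) s))
      + int (card (D S\<^sub>1 \<inter> translate (nonzero_squares K) s)) | s. s \<in> K} = {m ^ 2 - m, m ^ 2}"
  "{int (card (D S\<^sub>0 \<inter> translate (nonzero_squares K) s))
      + int (card (D S\<^sub>1 \<inter> translate ((K - {0}) - nonzero_squares K) s)) | s. s \<in> K}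
    = {m ^ 2 - m, m ^ 2}"
proof -
  have "{int (card (D S\<^sub>0 \<inter> translate (nonzero_squares K \<union> {0}) s))
      + int (card (D S\<^sub>1 \<inter> translate (nonzero_squares K) s)) | s. s \<in> K}
    = (\<lambda>s. if s \<in> D S\<^sub>1 then m ^ 2 - m else m ^ 2) ` K"
    unfolding setcompr_eq_image Collect_mem_eq
    by (intro image_cong refl card_D_inter_translate_squares)
  also have "\<dots> = {m ^ 2 - m, m ^ 2}"
    by (intro image_if_mem_eq_pair D_nontrivial) simp_all
  finally show "{int (card (D S\<^sub>0 \<inter> translate (nonzero_squares K \<union> {0}) s))
      + int (card (D S\<^sub>1 \<inter> translate (nonzero_squares K) s)) | s. s \<in> K} = {m ^ 2 - m, m ^ 2}" .
  have "{int (card (D S\<^sub>0 \<inter> translate (nonzero_squares K) s))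
      + int (card (D S\<^sub>1 \<inter> translate ((K - {0}) - nonzero_squares K) s)) | s. s \<in> K}
    = (\<lambda>s. if s \<in> D S\<^sub>0 then m ^ 2 else m ^ 2 - m) ` K"
    unfolding setcompr_eq_image Collect_mem_eq
    by (intro image_cong refl card_D_inter_translate_nonsquares)
  also have "\<dots> = {m ^ 2, m ^ 2 - m}"
    by (intro image_if_mem_eq_pair D_nontrivial) simp_all
  finally show "{int (card (D S\<^sub>0 \<inter> translate (nonzero_squares K) s))
      + int (card (D S\<^sub>1 \<inter> translate ((K - {0}) - nonzero_squares K) s)) | s. s \<in> K}
    = {m ^ 2 - m, m ^ 2}"
    by (simp only: insert_commute)
qed

end

section \<open>Partitions into four unions of square classes\<close>

locale square_class_partition = quadratic_extension p f q K
  for p f q :: nat and K :: "'a::{field,finite} set" +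
  fixes n :: 'a and X :: "nat \<Rightarrow> 'a set"
  assumes n: "n \<in> K" "\<eta> n = - 1"
    and cover: "(\<Union>i\<in>{1..4}. X i) = UNIV - {0}"
    and disjoint: "disjoint_family_on X {1..4}"
    and X1: "X 1 = (\<lambda>x. n * x) ` X 3"
    and X2: "X 2 = (\<lambda>x. n * x) ` X 4"
    and square_mult: "i \<in> {1..4} \<Longrightarrow> c \<in> nonzero_squares K \<Longrightarrow> x \<in> X i \<Longrightarrow> c * x \<in> X i"
begin

lemma n_nonzero: "n \<noteq> 0"
  using n(2) by auto

lemma atLeastAtMost_1_4_nat: "{1..4::nat} = {1, 2, 3, 4}"
  by auto

lemma cover_cases:
  assumes "z \<noteq> 0"
  obtains "z \<in> X 1" | "z \<in> X 2" | "z \<in> X 3" | "z \<in> X 4"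
proof -
  have "z \<in> (\<Union>i\<in>{1, 2, 3, 4}. X i)"
    using cover assms unfolding atLeastAtMost_1_4_nat by simp
  then show ?thesis
    using that by blast
qed

lemma X_disjoint: "i \<in> {1..4} \<Longrightarrow> j \<in> {1..4} \<Longrightarrow> i \<noteq> j \<Longrightarrow> X i \<inter> X j = {}"
  using disjoint unfolding disjoint_family_on_def by blast

lemma pairwise_X_disjoint:
  "X 1 \<inter> X 2 = {}" "X 1 \<inter> X 3 = {}" "X 1 \<inter> X 4 = {}"
  "X 2 \<inter> X 3 = {}" "X 2 \<inter> X 4 = {}" "X 3 \<inter> X 4 = {}"
  by (rule X_disjoint; simp)+

lemma nonsquare_mult_swap:
  assumes "A = (\<lambda>x. n * x) ` X i" "i \<in> {1..4}"
  shows "n * z \<in> A \<longleftrightarrow> z \<in> X i" "n * z \<in> X i \<longleftrightarrow> z \<in> A"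
proof -
  show "n * z \<in> A \<longleftrightarrow> z \<in> X i"
    using n_nonzero by (auto simp: assms(1))
  have n_square: "n * n \<in> nonzero_squares K"
    using n by (simp add: nonzero_squares_iff quadratic_char_mult)
  show "n * z \<in> X i \<longleftrightarrow> z \<in> A"
  proof
    assume "n * z \<in> X i"
    then have "1 / (n * n) * (n * z) \<in> X i"
      by (rule square_mult[OF assms(2) nonzero_squares_inverse[OF n_square]])
    moreover have "z = n * (1 / (n * n) * (n * z))"
      using n_nonzero by simp
    ultimately show "z \<in> A"
      unfolding assms(1) by (rule rev_image_eqI)
  next
    assume "z \<in> A"
    then obtain x where "x \<in> X i" "z = n * x"
      by (auto simp: assms(1))
    then show "n * z \<in> X i"
      using square_mult[OF assms(2) n_square] by (simp add: mult.assoc)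
  qed
qed

lemma nonsquare_mult_iff:
  "n * z \<in> X 1 \<longleftrightarrow> z \<in> X 3" "n * z \<in> X 3 \<longleftrightarrow> z \<in> X 1"
  "n * z \<in> X 2 \<longleftrightarrow> z \<in> X 4" "n * z \<in> X 4 \<longleftrightarrow> z \<in> X 2"
  using nonsquare_mult_swap[OF X1] nonsquare_mult_swap[OF X2] by auto

lemma homogeneous_signed_indicator_Un:
  assumes S: "S \<in> {X 1 \<union> X 4, X 1 \<union> X 2, X 2 \<union> X 3, X 3 \<union> X 4}"
  shows "homogeneous (signed_indicator S)"
proof (rule homogeneous_signed_indicator[OF n])
  fix c z
  assume "c \<in> nonzero_squares K" "z \<in> S"
  then show "c * z \<in> S"
    using S square_mult by auto
next
  fix z :: 'a
  assume "z \<noteq> 0"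
  then show "n * z \<in> S \<longleftrightarrow> z \<notin> S"
    using S pairwise_X_disjoint nonsquare_mult_iff[of z] by (cases rule: cover_cases) auto
qed

lemma fourier_signed_indicator_Un:
  assumes "{i, j, k, l} = {1..4}" "distinct [i, j, k, l]"
  shows "fourier (signed_indicator (X i \<union> X j)) a
    = \<Psi>_sum a (X i) + \<Psi>_sum a (X j)
      - (\<Psi>_sum a (X k) + \<Psi>_sum a (X l))"
proof -
  have "(X i \<union> X j) \<union> (X k \<union> X l) = UNIV - {0}"
    unfolding cover[symmetric] assms(1)[symmetric] by auto
  moreover have disj: "X a \<inter> X b = {}" if "a \<in> {i, j, k, l}" "b \<in> {i, j, k, l}" "a \<noteq> b" for a b
    using that unfolding assms(1) by (rule X_disjoint)
  then have "(X i \<union> X j) \<inter> (X k \<union> X l) = {}"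
    using assms(2) by (simp add: Int_Un_distrib Int_Un_distrib2)
  moreover have "\<Psi>_sum a (X i \<union> X j)
      = \<Psi>_sum a (X i) + \<Psi>_sum a (X j)"
    "\<Psi>_sum a (X k \<union> X l)
      = \<Psi>_sum a (X k) + \<Psi>_sum a (X l)"
    using assms(2) disj by (auto simp: add_char_sum_def intro!: sum.union_disjoint)
  ultimately show ?thesis
    by (simp only: fourier_signed_indicator)
qed

definition opposite_differences :: "'a \<Rightarrow> complex \<times> complex" where
  "opposite_differences a =
     (\<Psi>_sum a (X 1) - \<Psi>_sum a (X 3),
      \<Psi>_sum a (X 2) - \<Psi>_sum a (X 4))"

lemma opposite_differences_eq:
  assumes "map (\<lambda>i. \<Psi>_sum a (X i)) [1, 2, 3, 4] = [c\<^sub>1, c\<^sub>2, c\<^sub>3, c\<^sub>4]"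
  shows "opposite_differences a = (c\<^sub>1 - c\<^sub>3, c\<^sub>2 - c\<^sub>4)"
  using assms by (simp add: opposite_differences_def)

lemma fourier_signed_indicator_opposite_differences:
  assumes "opposite_differences a = (d\<^sub>1, d\<^sub>2)"
  shows "fourier (signed_indicator (X 1 \<union> X 4)) a = d\<^sub>1 - d\<^sub>2"
    and "fourier (signed_indicator (X 1 \<union> X 2)) a = d\<^sub>1 + d\<^sub>2"
proof -
  have "{1, 4, 2, 3} = {1..4::nat}" "{1, 2, 3, 4} = {1..4::nat}"
    by auto
  from this[THEN fourier_signed_indicator_Un] assms show
    "fourier (signed_indicator (X 1 \<union> X 4)) a = d\<^sub>1 - d\<^sub>2"
    "fourier (signed_indicator (X 1 \<union> X 2)) a = d\<^sub>1 + d\<^sub>2"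
    by (auto simp: opposite_differences_def)
qed

text \<open>
  On \<open>X 1\<close>, \<open>X 2\<close>, \<open>X 3\<close>, \<open>X 4\<close> the signs of \<open>X 1 \<union> X 4\<close> and \<open>X 1 \<union> X 2\<close> are \<open>(1, 1)\<close>, \<open>(- 1, 1)\<close>,
  \<open>(- 1, - 1)\<close>, \<open>(1, - 1)\<close>. Expressed in these signs, the four rows below become one formula, which
  is the one in \<open>fourier_pair\<close>.
\<close>

definition difference_row :: "complex \<Rightarrow> nat \<Rightarrow> complex \<times> complex" where
  "difference_row M j =
     [(- M * G, - (M + 1) * G), (- (M - 1) * G, M * G),
      (M * G, (M + 1) * G), ((M - 1) * G, - M * G)] ! (j - 1)"

lemma signed_indicator_Un_values:
  assumes "z \<noteq> 0"
  shows "z \<in> X 1 \<Longrightarrow> signed_indicator (X 1 \<union> X 4) z = 1 \<and> signed_indicator (X 1 \<union> X 2) z = 1"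
    and "z \<in> X 2 \<Longrightarrow> signed_indicator (X 1 \<union> X 4) z = - 1 \<and> signed_indicator (X 1 \<union> X 2) z = 1"
    and "z \<in> X 3 \<Longrightarrow> signed_indicator (X 1 \<union> X 4) z = - 1 \<and> signed_indicator (X 1 \<union> X 2) z = - 1"
    and "z \<in> X 4 \<Longrightarrow> signed_indicator (X 1 \<union> X 4) z = 1 \<and> signed_indicator (X 1 \<union> X 2) z = - 1"
  using assms pairwise_X_disjoint by (auto simp: signed_indicator_def)

lemma signed_indicator_Un_opposite:
  "signed_indicator (X 2 \<union> X 3) = (\<lambda>z. - signed_indicator (X 1 \<union> X 4) z)"
  "signed_indicator (X 3 \<union> X 4) = (\<lambda>z. - signed_indicator (X 1 \<union> X 2) z)"
  using cover pairwise_X_disjoint unfolding atLeastAtMost_1_4_nat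
  by (auto intro!: signed_indicator_complement)

lemma fourier_pair_of_difference_row:
  assumes S: "(S\<^sub>0, S\<^sub>1) \<in> {(X 1 \<union> X 4, X 1 \<union> X 2), (X 2 \<union> X 3, X 3 \<union> X 4)}"
    and z: "z \<noteq> 0" and row: "\<And>j. j \<in> {1..4} \<Longrightarrow> z \<in> X j \<Longrightarrow> opposite_differences b = difference_row M j"
  shows "fourier_pair M S\<^sub>0 S\<^sub>1 b z"
proof -
  define A B where "A = X 1 \<union> X 4" and "B = X 1 \<union> X 2"
  note signs = signed_indicator_Un_values[OF z, folded A_def B_def]
  obtain d\<^sub>1 d\<^sub>2 where d: "opposite_differences b = (d\<^sub>1, d\<^sub>2)"
    by fastforce
  note fourier = fourier_signed_indicator_opposite_differences[OF d, folded A_def B_def]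
  have pair_AB: "fourier_pair M A B b z"
    unfolding fourier_pair_def using z
    by (cases rule: cover_cases; use row[of 1] row[of 2] row[of 3] row[of 4] signs d fourier
        in \<open>simp add: difference_row_def\<close>; simp add: algebra_simps)
  consider (same) "S\<^sub>0 = A" "S\<^sub>1 = B" | (opposite) "S\<^sub>0 = X 2 \<union> X 3" "S\<^sub>1 = X 3 \<union> X 4"
    using S unfolding A_def B_def by blast
  then show ?thesis
  proof cases
    case same
    with pair_AB show ?thesis
      by (simp only:)
  next
    case opposite
    show ?thesis
      unfolding opposite fourier_pair_def signed_indicator_Un_opposite[folded A_def B_def]
        fourier_uminus pair_AB[unfolded fourier_pair_def, THEN conjunct1]
        pair_AB[unfolded fourier_pair_def, THEN conjunct2]
      by (simp add: algebra_simps)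
  qed
qed

end

section \<open>Partitions into unions of cyclotomic classes\<close>

locale cyclotomic_partition = quadratic_extension p f q K
  for p f q :: nat and K :: "'a::{field,finite} set" +
  fixes \<omega> :: 'a and X :: "nat \<Rightarrow> 'a set"
  assumes primitive: "primitive_element \<omega>"
    and Union_X: "(\<Union>i\<in>{1..4}. X i) = UNIV - {0}"
    and disjoint_X: "disjoint_family_on X {1..4}"
    and X1_eq: "X 1 = (\<lambda>x. \<omega> powi (int q + 1) * x) ` X 3"
    and X2_eq: "X 2 = (\<lambda>x. \<omega> powi (int q + 1) * x) ` X 4"
    and X_classes: "\<forall>i\<in>{1..4}. \<exists>J. X i = (\<Union>j\<in>J. cyclotomic_class \<omega> (2 * (int q + 1)) j)"
begin

lemma powi_in_K_iff: "\<omega> powi j \<in> K \<longleftrightarrow> int q + 1 dvd j"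
  using primitive_element_powi_in_GF_iff[OF primitive index_mult q_gt_1]
  by (simp add: K_eq add.commute)

lemma cyclotomic_class_eq:
  "cyclotomic_class \<omega> (2 * (int q + 1)) i = (\<lambda>c. \<omega> powi i * c) ` nonzero_squares K"
  using cyclotomic_class_eq_image_nonzero_squares[OF primitive index_mult q_gt_1]
  by (simp add: K_eq add.commute)

sublocale square_class_partition p f q K "\<omega> powi (int q + 1)" X
proof
  show "\<omega> powi (int q + 1) \<in> K"
    by (simp add: powi_in_K_iff)
  have "\<omega> powi (int q + 1) = \<omega> ^ (q + 1)"
    using power_int_of_nat[of \<omega> "q + 1"] by (simp add: add.commute)
  then show "\<eta> (\<omega> powi (int q + 1)) = - 1"
    using primitive_element_power_not_square[OF primitive index_mult q_gt_1 odd_q]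
      primitive_element_nonzero[OF primitive] by (simp add: quadratic_char_def K_eq)
  fix i c x
  assume i: "i \<in> {1..4}" and c: "c \<in> nonzero_squares K" and x: "x \<in> X i"
  obtain J where J: "X i = (\<Union>j\<in>J. (\<lambda>c. \<omega> powi j * c) ` nonzero_squares K)"
    using bspec[OF X_classes i] unfolding cyclotomic_class_eq by blast
  with x obtain j d where "j \<in> J" "d \<in> nonzero_squares K" "x = \<omega> powi j * d"
    by blast
  moreover from this have "c * x = \<omega> powi j * (c * d)"
    by simp
  ultimately show "c * x \<in> X i"
    unfolding J using nonzero_squares_mult[OF c] by blast
qed (fact Union_X disjoint_X X1_eq X2_eq)+

lemma uminus_mem_cyclotomic_class:
  assumes "4 dvd q - 1" "\<delta> \<in> cyclotomic_class \<omega> (2 * (int q + 1)) k"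
  shows "- \<delta> \<in> cyclotomic_class \<omega> (2 * (int q + 1)) k"
proof -
  obtain c where "c \<in> nonzero_squares K" "- \<delta> = \<omega> powi k * (- 1 * c)"
    using assms(2) unfolding cyclotomic_class_eq by auto
  then show ?thesis
    unfolding cyclotomic_class_eq
    using nonzero_squares_mult[OF minus_one_square[OF assms(1)]] by blast
qed

lemma power_q_div_mem_image:
  assumes \<delta>: "\<delta> \<in> cyclotomic_class \<omega> (2 * (int q + 1)) k" and j: "j \<in> {1..4}" and z: "z \<in> X j"
  shows "z ^ q / \<delta> \<in> (\<lambda>x. \<omega> powi (- k) * x ^ q) ` X j"
proof -
  obtain c where c: "c \<in> nonzero_squares K" "\<delta> = \<omega> powi k * c"
    using \<delta> unfolding cyclotomic_class_eq by blast
  then have "(1 / c * z) ^ q = z ^ q / c"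
    using nonzero_squares_subset by (auto simp: power_divide K_iff)
  then have "z ^ q / \<delta> = \<omega> powi (- k) * (1 / c * z) ^ q"
    unfolding c(2) by (simp add: power_int_minus divide_inverse mult_ac)
  moreover have "1 / c * z \<in> X j"
    by (rule square_mult[OF j nonzero_squares_inverse[OF c(1)] z])
  ultimately show ?thesis
    by (rule image_eqI)
qed

lemma signed_line_pairI:
  fixes m k l :: int and Y :: "nat \<Rightarrow> 'a set"
  defines "L \<equiv> \<omega> powi l"
  assumes m: "odd m" "int q = 2 * m ^ 2 - 1"
    and L: "\<not> int q + 1 dvd l" "L \<in> X 2 \<union> X 4"
      "\<omega> powi (l * int q) - L \<in> cyclotomic_class \<omega> (2 * (int q + 1)) k"
    and S: "L \<in> X 2 \<longrightarrow> S\<^sub>0 = X 1 \<union> X 4 \<and> S\<^sub>1 = X 1 \<union> X 2"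
      "L \<in> X 4 \<longrightarrow> S\<^sub>0 = X 2 \<union> X 3 \<and> S\<^sub>1 = X 3 \<union> X 4"
    and Y: "\<forall>j\<in>{1..4}. Y j = (\<lambda>x. \<omega> powi (- k) * x ^ q) ` X j"
    and rows: "\<forall>j\<in>{1..4}. \<forall>a\<in>Y j. opposite_differences a = difference_row (of_int m) j"
  shows "signed_line_pair p f q K m L S\<^sub>0 S\<^sub>1"
proof
  show "int q = 2 * m ^ 2 - 1" "L \<notin> K" "L \<notin> S\<^sub>0" "L \<in> S\<^sub>1"
    using m(2) L(1,2) S pairwise_X_disjoint by (auto simp: L_def powi_in_K_iff)
  have pairs: "(S\<^sub>0, S\<^sub>1) \<in> {(X 1 \<union> X 4, X 1 \<union> X 2), (X 2 \<union> X 3, X 3 \<union> X 4)}"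
    using L(2) S by blast
  then show "homogeneous (signed_indicator S\<^sub>0)" "homogeneous (signed_indicator S\<^sub>1)"
    by (intro homogeneous_signed_indicator_Un; blast)+
  have "4 dvd int q - 1"
    using m by (auto elim!: oddE simp: power2_eq_square algebra_simps)
  then have "4 dvd q - 1"
    by presburger
  fix v \<delta> :: 'a
  assume v: "v \<noteq> 0" and \<delta>: "\<delta> \<in> {L ^ q - L, L - L ^ q}"
  then have "\<delta> \<in> cyclotomic_class \<omega> (2 * (int q + 1)) k"
    using L(3) uminus_mem_cyclotomic_class[OF \<open>4 dvd q - 1\<close> L(3)]
    by (auto simp: L_def power_int_power')
  then have "v ^ q / \<delta> \<in> Y j" if "j \<in> {1..4}" "v \<in> X j" for j
    using power_q_div_mem_image that Y by blast
  with rows show "fourier_pair (of_int m) S\<^sub>0 S\<^sub>1 (v ^ q / \<delta>) v"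
    by (intro fourier_pair_of_difference_row[OF pairs v]) blast
qed

end

theorem theorem6p4:
  fixes m \<tau> l :: int
    and p f q :: nat
    and \<omega> :: "'a::{field,finite}"
    and X Y :: "nat \<Rightarrow> 'a set"
    and S\<^sub>0 S\<^sub>1 :: "'a set"
    and M g :: complex
    and D :: "'a set \<Rightarrow> 'a set"
  assumes "odd m"
    and "int q = 2 * m ^ 2 - 1"
    and "prime p" and "f > 0" and "q = p ^ f"
    and "CARD('a) = q ^ 2"
    and "primitive_element \<omega>"
    and "X 0 = {0}"
    and "(\<Union>i\<in>{1..4}. X i) = UNIV - {0}"
    and "disjoint_family_on X {1..4}"
    and "\<forall>i\<in>{1..4}. X i \<noteq> {}"
    and "X 1 = (\<lambda>x. \<omega> powi (2 * m ^ 2) * x) ` X 3"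
    and "X 2 = (\<lambda>x. \<omega> powi (2 * m ^ 2) * x) ` X 4"
    and "\<forall>i\<in>{1..4}. \<exists>J. X i = (\<Union>j\<in>J. cyclotomic_class \<omega> (4 * m ^ 2) j)"
    and "association_scheme UNIV 4 (\<lambda>i. {(x, y). x - y \<in> X i})"
    and "\<tau> \<in> {1, - 1}"
    and "Y 0 = {0}"
    and "\<forall>j\<in>{1..4}. Y j = (\<lambda>x. \<omega> powi (- (m ^ 2) * \<tau>) * x ^ q) ` X j"
    and "g = gauss_sum p f (quadratic_char (GF q :: 'a set))"
    and "M = of_int m"
    and "\<forall>a\<in>Y 0. map (\<lambda>i. add_char_sum p (2 * f) a (X i)) [1, 2, 3, 4] =
      [M * (M ^ 2 - 1) * (M - 1), M * (M ^ 2 - 1) * (M + 1),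
       M * (M ^ 2 - 1) * (M - 1), M * (M ^ 2 - 1) * (M + 1)]"
    and "\<forall>a\<in>Y 1. map (\<lambda>i. add_char_sum p (2 * f) a (X i)) [1, 2, 3, 4] =
      [(M ^ 2 + M - 1) / 2 - M / 2 * g, (- (M ^ 2) - M) / 2 - (M + 1) / 2 * g,
       (M ^ 2 + M - 1) / 2 + M / 2 * g, (- (M ^ 2) - M) / 2 + (M + 1) / 2 * g]"
    and "\<forall>a\<in>Y 2. map (\<lambda>i. add_char_sum p (2 * f) a (X i)) [1, 2, 3, 4] =
      [(- (M ^ 2) + M) / 2 - (M - 1) / 2 * g, (M ^ 2 - M - 1) / 2 + M / 2 * g,
       (- (M ^ 2) + M) / 2 + (M - 1) / 2 * g, (M ^ 2 - M - 1) / 2 - M / 2 * g]"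
    and "\<forall>a\<in>Y 3. map (\<lambda>i. add_char_sum p (2 * f) a (X i)) [1, 2, 3, 4] =
      [(M ^ 2 + M - 1) / 2 + M / 2 * g, (- (M ^ 2) - M) / 2 + (M + 1) / 2 * g,
       (M ^ 2 + M - 1) / 2 - M / 2 * g, (- (M ^ 2) - M) / 2 - (M + 1) / 2 * g]"
    and "\<forall>a\<in>Y 4. map (\<lambda>i. add_char_sum p (2 * f) a (X i)) [1, 2, 3, 4] =
      [(- (M ^ 2) + M) / 2 + (M - 1) / 2 * g, (M ^ 2 - M - 1) / 2 - M / 2 * g,
       (- (M ^ 2) + M) / 2 - (M - 1) / 2 * g, (M ^ 2 - M - 1) / 2 + M / 2 * g]"
    and "\<not> (int q + 1) dvd l"
    and "\<omega> powi l \<in> X 2 \<union> X 4"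
    and "\<omega> powi (l * int q) - \<omega> powi l \<in> cyclotomic_class \<omega> (4 * m ^ 2) (\<tau> * m ^ 2)"
    and "\<omega> powi l \<in> X 2 \<longrightarrow> S\<^sub>0 = X 1 \<union> X 4 \<and> S\<^sub>1 = X 1 \<union> X 2"
    and "\<omega> powi l \<in> X 4 \<longrightarrow> S\<^sub>0 = X 2 \<union> X 3 \<and> S\<^sub>1 = X 3 \<union> X 4"
    and "\<forall>S. D S = {x \<in> GF q. 1 + x * \<omega> powi l \<in> S}"
  shows "int (card (D S\<^sub>0)) = m ^ 2 - m \<and>
    int (card (D S\<^sub>1)) = m ^ 2 \<and>
    {int (card (D S\<^sub>0 \<inter> translate (nonzero_squares (GF q) \<union> {0}) s)) +
          int (card (D S\<^sub>1 \<inter> translate (nonzero_squares (GF q)) s)) | s. s \<in> GF q}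
         = {m ^ 2 - m, m ^ 2} \<and>
    {int (card (D S\<^sub>0 \<inter> translate (nonzero_squares (GF q)) s)) +
          int (card (D S\<^sub>1 \<inter> translate ((GF q - {0}) - nonzero_squares (GF q)) s)) | s. s \<in> GF q}
         = {m ^ 2 - m, m ^ 2}"
proof -
  have q_plus_1: "4 * m ^ 2 = 2 * (int q + 1)" "2 * m ^ 2 = int q + 1"
    using assms(2) by simp_all
  have "odd (int q)"
    unfolding assms(2) by simp
  then interpret cyclotomic_partition p f q "GF q" \<omega> X
    by unfold_locales (use assms(3-7,9,10,12-14) in \<open>simp_all add: q_plus_1\<close>)
  note rows = assms(22-25)[THEN bspec, THEN opposite_differences_eq]
  have "\<forall>j\<in>{1..4}. \<forall>a\<in>Y j. opposite_differences a = difference_row M j"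
    unfolding atLeastAtMost_1_4_nat
    by (simp add: rows difference_row_def assms(19) del: One_nat_def) (simp add: field_simps)
  moreover have "\<forall>j\<in>{1..4}. Y j = (\<lambda>x. \<omega> powi - (\<tau> * m ^ 2) * x ^ q) ` X j"
    using assms(18) by (simp add: mult.commute)
  ultimately interpret signed_line_pair p f q "GF q" m "\<omega> powi l" S\<^sub>0 S\<^sub>1
    using assms(1,2,26-30) unfolding q_plus_1(1) assms(19,20)
    by (intro signed_line_pairI[where Y = Y and k = "\<tau> * m ^ 2"])
  have "D S = signed_line_pair.D (GF q) (\<omega> powi l) S" for S
    unfolding D_def using assms(31) by simp
  then show ?thesis
    using card_D intersection_numbers by simp
qed

end
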